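(* Let $G$ be a periodic nilpotent group. Then $G$ contains a solution of every (possibly infinite) unimodular system of equations over $G$ if and only if only finitely many $p$-components of $G$ have nontrivial first Ulm factor and each of these first Ulm factors has bounded period.
   Context: An equation over a group $G$ in variables $\{x_j\}_{j\in J}$ is an expression $w=1$ with $w$ an element of the free product $G * F(\{x_j\}_{j\in J})$, where $F$ is the free group on the $x_j$ (so coefficients from $G$ are allowed). A system of equations $\{w_i=1\}_{i\in I}$ may have infinitely many equations and infinitely many variables. $G$ contains a solution of the system if there are elements $g_j\in G$ such that substituting $x_j\mapsto g_j$ makes every $w_i$ equal to $1$ in $G$. For each equation $w_i$, form the row whose $j$-th entry is the exponent sum of $x_j$ in $w_i$ (e.g. the exponent sum of $y$ in $x^2y^{-3}g_1xy^2xy^2x^{-1}y^{-2}g_2$ is $-1$). The system is $p$-nonsingular ($p$ prime) if these rows are linearly independent over the field $\mathbb Z_p$ of order $p$ (for infinitely many rows: every finite subset is linearly independent), and unimodular if it is $p$-nonsingular for every prime $p$. For a periodic nilpotent group $G$, its $p$-component is the subgroup of elements of $p$-power order. For a nilpotent $p$-group $P$, the height of $g\in P$ is the greatest $n$ with $g=h^{p^n}$ for some $h\in P$; if no greatest such $n$ exists, $g$ has infinite height. The elements of infinite height form a normal subgroup $P_0$, and the first Ulm factor of $P$ is $P/P_0$. A group has bounded period if there is $n\ge1$ with $g^n=1$ for all its elements $g$. *)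

theory Defs
  imports "HOL-Algebra.Algebra"
begin

definition comm_set :: "('a,'b) monoid_scheme \<Rightarrow> 'a set \<Rightarrow> 'a set \<Rightarrow> 'a set" where
  "comm_set G A B = {a \<otimes>\<^bsub>G\<^esub> b \<otimes>\<^bsub>G\<^esub> inv\<^bsub>G\<^esub> a \<otimes>\<^bsub>G\<^esub> inv\<^bsub>G\<^esub> b | a b. a \<in> A \<and> b \<in> B}"

fun lower_central :: "('a,'b) monoid_scheme \<Rightarrow> nat \<Rightarrow> 'a set" where
  "lower_central G 0 = carrier G"
| "lower_central G (Suc n) = generate G (comm_set G (lower_central G n) (carrier G))"

definition nilpotent_group :: "('a,'b) monoid_scheme \<Rightarrow> bool" where
  "nilpotent_group G \<longleftrightarrow> group G \<and> (\<exists>n. lower_central G n = {\<one>\<^bsub>G\<^esub>})"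

definition periodic_group :: "('a,'b) monoid_scheme \<Rightarrow> bool" where
  "periodic_group G \<longleftrightarrow> (\<forall>g\<in>carrier G. \<exists>n::nat. n \<ge> 1 \<and> g [^]\<^bsub>G\<^esub> n = \<one>\<^bsub>G\<^esub>)"

definition bounded_period :: "('a,'b) monoid_scheme \<Rightarrow> bool" where
  "bounded_period H \<longleftrightarrow> (\<exists>n::nat. n \<ge> 1 \<and> (\<forall>g\<in>carrier H. g [^]\<^bsub>H\<^esub> n = \<one>\<^bsub>H\<^esub>))"

definition p_component :: "('a,'b) monoid_scheme \<Rightarrow> nat \<Rightarrow> 'a set" where
  "p_component G p = {g \<in> carrier G. \<exists>k::nat. g [^]\<^bsub>G\<^esub> (p ^ k) = \<one>\<^bsub>G\<^esub>}"

definition p_component_group :: "('a,'b) monoid_scheme \<Rightarrow> nat \<Rightarrow> ('a,'b) monoid_scheme" where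
  "p_component_group G p = G\<lparr>carrier := p_component G p\<rparr>"

definition infinite_height_part :: "('a,'b) monoid_scheme \<Rightarrow> nat \<Rightarrow> 'a set" where
  "infinite_height_part P p =
     {g \<in> carrier P. \<forall>n::nat. \<exists>h\<in>carrier P. g = h [^]\<^bsub>P\<^esub> (p ^ n)}"

definition first_ulm_factor :: "('a,'b) monoid_scheme \<Rightarrow> nat \<Rightarrow> 'a set monoid" where
  "first_ulm_factor P p = P Mod (infinite_height_part P p)"

definition nontrivial_group :: "('a,'b) monoid_scheme \<Rightarrow> bool" where
  "nontrivial_group H \<longleftrightarrow> carrier H \<noteq> {\<one>\<^bsub>H\<^esub>}"

text \<open>A word in the free product G * F(variables): a list of letters, each either a
  constant Inl g (g in G) or a variable letter Inr (j, True) = x_j or Inr (j, False) = x_j^-1.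
  Every element of the free product is represented by such a word; substitution and
  exponent sums are invariant under free reduction.\<close>
type_synonym ('a,'j) word = "('a + 'j \<times> bool) list"

definition is_equation :: "('a,'b) monoid_scheme \<Rightarrow> ('a,'j) word \<Rightarrow> bool" where
  "is_equation G w \<longleftrightarrow> (\<forall>g. Inl g \<in> set w \<longrightarrow> g \<in> carrier G)"

fun letter_val :: "('a,'b) monoid_scheme \<Rightarrow> ('j \<Rightarrow> 'a) \<Rightarrow> ('a + 'j \<times> bool) \<Rightarrow> 'a" where
  "letter_val G s (Inl g) = g"
| "letter_val G s (Inr (j, b)) = (if b then s j else inv\<^bsub>G\<^esub> (s j))"

definition eval_word :: "('a,'b) monoid_scheme \<Rightarrow> ('j \<Rightarrow> 'a) \<Rightarrow> ('a,'j) word \<Rightarrow> 'a" where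
  "eval_word G s w = foldr (\<lambda>l acc. letter_val G s l \<otimes>\<^bsub>G\<^esub> acc) w \<one>\<^bsub>G\<^esub>"

fun letter_exp :: "'j \<Rightarrow> ('a + 'j \<times> bool) \<Rightarrow> int" where
  "letter_exp j (Inl g) = 0"
| "letter_exp j (Inr (i, b)) = (if i = j then (if b then 1 else -1) else 0)"

definition exp_sum :: "('a,'j) word \<Rightarrow> 'j \<Rightarrow> int" where
  "exp_sum w j = sum_list (map (letter_exp j) w)"

text \<open>A system is a set of equations; its rows (exponent-sum vectors) are linearly
  independent over Z_p if every finite subfamily is.\<close>
definition p_nonsingular :: "nat \<Rightarrow> ('a,'j) word set \<Rightarrow> bool" where
  "p_nonsingular p E \<longleftrightarrow>
     (\<forall>S c. finite S \<and> S \<subseteq> E \<and>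
        (\<forall>j. int p dvd (\<Sum>w\<in>S. c w * exp_sum w j)) \<longrightarrow> (\<forall>w\<in>S. int p dvd c w))"

definition unimodular :: "('a,'j) word set \<Rightarrow> bool" where
  "unimodular E \<longleftrightarrow> (\<forall>p. Factorial_Ring.prime p \<longrightarrow> p_nonsingular p E)"

definition has_solution :: "('a,'b) monoid_scheme \<Rightarrow> ('a,'j) word set \<Rightarrow> bool" where
  "has_solution G E \<longleftrightarrow>
     (\<exists>s. (\<forall>j. s j \<in> carrier G) \<and> (\<forall>w\<in>E. eval_word G s w = \<one>\<^bsub>G\<^esub>))"

end

theory Submission
  imports Defs
begin

text \<open>
  Let \<open>D\<close> be the set of elements of \<open>G\<close> that have an \<open>n\<close>-th root for every \<open>n \<ge> 1\<close>. In a nilpotent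
  group a sufficiently high power \<open>h\<^bsup>m\<^sup>c\<^esup>\<close> commutes with every element killed by \<open>m\<close>; so in a
  periodic nilpotent group \<open>D\<close> is a central subgroup, and the elements of infinite height in the
  \<open>p\<close>-component \<open>P\<close> are exactly \<open>D \<inter> P\<close>. Hence the condition on the Ulm factors says that \<open>G/D\<close> has
  bounded period.

  If \<open>G/D\<close> has bounded period, then \<open>D\<close> is divisible and \<open>G\<close> has a central series whose lowest term
  is \<open>D\<close> and whose remaining sections have prime exponent. A solution modulo one term of the series
  is corrected to a solution modulo the next by solving a linear system in the section, that is, by
  extending a homomorphism from the span of the rows to \<open>\<int>\<^sup>J\<close>.

  Conversely, apply solvability to systems \<open>x\<^sub>i = a\<^sub>i x\<^sub>i\<^sub>+\<^sub>1\<^bsup>n\<^sub>i\<^esup>\<close>, which are unimodular. If the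
  abelianization were unbounded modulo its divisible elements, the coefficients could be chosen such
  that \<open>x\<^sub>0\<close> has infinite order. So \<open>N\<close>-th powers are divisible in the abelianization for some \<open>N\<close>;
  since \<open>[x, -]\<close> is a homomorphism modulo the next term of the lower central series, the derived
  subgroup then has bounded period, and the bound lifts to \<open>G\<close>.
\<close>

section \<open>Commutators and the lower central series\<close>

definition commutator :: "('a,'b) monoid_scheme \<Rightarrow> 'a \<Rightarrow> 'a \<Rightarrow> 'a" where
  "commutator G x y = x \<otimes>\<^bsub>G\<^esub> y \<otimes>\<^bsub>G\<^esub> inv\<^bsub>G\<^esub> x \<otimes>\<^bsub>G\<^esub> inv\<^bsub>G\<^esub> y"

lemma comm_set_eq: "comm_set G A B = {commutator G a b | a b. a \<in> A \<and> b \<in> B}"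
  by (simp add: comm_set_def commutator_def)

context group
begin

lemma inv_mult_cancel [simp]:
  "\<lbrakk>x \<in> carrier G; y \<in> carrier G\<rbrakk> \<Longrightarrow> inv x \<otimes> (x \<otimes> y) = y"
  "\<lbrakk>x \<in> carrier G; y \<in> carrier G\<rbrakk> \<Longrightarrow> x \<otimes> (inv x \<otimes> y) = y"
  by (simp_all flip: m_assoc)

lemma commutator_closed [simp, intro]:
  "\<lbrakk>x \<in> carrier G; y \<in> carrier G\<rbrakk> \<Longrightarrow> commutator G x y \<in> carrier G"
  by (simp add: commutator_def)

text \<open>Read as a rewriting rule: \<open>z\<close> is the factor paid for swapping
  \<open>x\<close> and \<open>y\<close>. In this form products are handled without unfolding
  inverses.\<close>

lemma commutator_eq_iff:
  assumes "x \<in> carrier G" "y \<in> carrier G" "z \<in> carrier G"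
  shows "commutator G x y = z \<longleftrightarrow> x \<otimes> y = z \<otimes> (y \<otimes> x)"
proof -
  have "commutator G x y = (x \<otimes> y) \<otimes> inv (y \<otimes> x)"
    using assms by (simp add: commutator_def m_assoc inv_mult_group)
  then show ?thesis
    using assms by (metis inv_solve_right' m_closed)
qed

lemma commutator_eq_one_iff:
  assumes "x \<in> carrier G" "y \<in> carrier G"
  shows "commutator G x y = \<one> \<longleftrightarrow> x \<otimes> y = y \<otimes> x"
  using assms by (simp add: commutator_eq_iff)

lemma inv_commutator:
  assumes "x \<in> carrier G" "y \<in> carrier G"
  shows "inv (commutator G x y) = commutator G y x"
  using assms by (simp add: commutator_def m_assoc inv_mult_group)

text \<open>Each of the \<open>n\<close> copies of \<open>x\<close> that passes \<open>y\<close>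
  leaves one factor \<open>z = commutator G x y\<close>; as \<open>z\<close> commutes with
  \<open>x\<close>, these factors collect on the left.\<close>

lemma commutator_pow_left:
  assumes x: "x \<in> carrier G" and y: "y \<in> carrier G"
    and comm: "x \<otimes> commutator G x y = commutator G x y \<otimes> x"
  shows "commutator G (x [^] (n::nat)) y = commutator G x y [^] n"
proof -
  define z where "z = commutator G x y"
  have z: "z \<in> carrier G" and zx: "x \<otimes> z = z \<otimes> x" and xy: "x \<otimes> y = z \<otimes> (y \<otimes> x)"
    using x y comm commutator_eq_iff[OF x y, of z] by (auto simp: z_def)
  have "x [^] n \<otimes> y = z [^] n \<otimes> (y \<otimes> x [^] n)"
  proof (induction n)
    case (Suc n)
    have xz: "x [^] n \<otimes> z = z \<otimes> x [^] n"
      using group_commutes_pow[OF zx x z] .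
    have "x [^] Suc n \<otimes> y = x [^] n \<otimes> (z \<otimes> (y \<otimes> x))"
      using x y xy by (simp add: m_assoc)
    also have "\<dots> = z \<otimes> (x [^] n \<otimes> y) \<otimes> x"
      using x y z xz by (simp flip: m_assoc)
    also have "\<dots> = z \<otimes> (z [^] n \<otimes> (y \<otimes> x [^] n)) \<otimes> x"
      using Suc by simp
    also have "\<dots> = z [^] Suc n \<otimes> (y \<otimes> x [^] Suc n)"
    proof -
      have "z [^] Suc n = z \<otimes> z [^] n" using z by (rule nat_pow_Suc2)
      then show ?thesis using x y z by (simp add: m_assoc)
    qed
    finally show ?case .
  qed (use x y in simp)
  then show ?thesis
    using x y z by (simp add: commutator_eq_iff flip: z_def)
qed

text \<open>Inversion swaps the arguments of a commutator, which reduces this to the power rule on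
  the left.\<close>

lemma commutator_pow_right:
  assumes x: "x \<in> carrier G" and y: "y \<in> carrier G"
    and comm: "y \<otimes> commutator G x y = commutator G x y \<otimes> y"
  shows "commutator G x (y [^] (n::nat)) = commutator G x y [^] n"
proof -
  have "y \<otimes> inv (commutator G x y) = inv (commutator G x y) \<otimes> y"
  proof -
    let ?z = "commutator G x y"
    have "inv ?z \<otimes> (y \<otimes> ?z) \<otimes> inv ?z = inv ?z \<otimes> (?z \<otimes> y) \<otimes> inv ?z"
      using comm by simp
    then show ?thesis using x y by (simp add: m_assoc)
  qed
  then have "commutator G (y [^] n) x = inv (commutator G x y) [^] n"
    using x y commutator_pow_left[of y x n] by (simp add: inv_commutator)
  then have "inv (commutator G (y [^] n) x) = commutator G x y [^] n"
    using x y by (simp add: nat_pow_inv)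
  then show ?thesis using x y by (simp add: inv_commutator)
qed

text \<open>In any group \<open>[x, yz]\<close> is \<open>[x, y]\<close> times the conjugate of
  \<open>[x, z]\<close> by \<open>y\<close>; the hypothesis makes the conjugation trivial.\<close>

lemma commutator_mult_right:
  assumes "x \<in> carrier G" "y \<in> carrier G" "z \<in> carrier G"
    and "y \<otimes> commutator G x z = commutator G x z \<otimes> y"
  shows "commutator G x (y \<otimes> z) = commutator G x y \<otimes> commutator G x z"
proof -
  have "commutator G x (y \<otimes> z) = commutator G x y \<otimes> (y \<otimes> commutator G x z \<otimes> inv y)"
    using assms(1-3) by (simp add: commutator_def m_assoc inv_mult_group)
  then show ?thesis
    using assms by (simp add: m_assoc)
qed

lemma commutator_mult_central_left:
  assumes "x \<in> carrier G" "y \<in> carrier G" "d \<in> carrier G"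
    and "\<And>g. g \<in> carrier G \<Longrightarrow> d \<otimes> g = g \<otimes> d"
  shows "commutator G (x \<otimes> d) y = commutator G x y"
proof -
  have "x \<otimes> d \<otimes> y = commutator G x y \<otimes> (y \<otimes> (x \<otimes> d))"
  proof -
    have "x \<otimes> d \<otimes> y = x \<otimes> y \<otimes> d"
      using assms by (simp add: m_assoc)
    also have "x \<otimes> y = commutator G x y \<otimes> (y \<otimes> x)"
      using assms commutator_eq_iff[of x y "commutator G x y"] by simp
    finally show ?thesis using assms by (simp add: m_assoc)
  qed
  then show ?thesis using assms by (simp add: commutator_eq_iff)
qed

end

lemma (in group_hom) hom_commutator:
  "\<lbrakk>x \<in> carrier G; y \<in> carrier G\<rbrakk> \<Longrightarrow> h (commutator G x y) = commutator H (h x) (h y)"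
  by (simp add: commutator_def)

section \<open>Commutators and powers modulo a normal subgroup\<close>

context normal
begin

lemma group_hom_quotient: "group_hom G (G Mod H) (r_coset G H)"
  using factorgroup_is_group r_coset_hom_Mod is_group
  by (simp add: group_hom_def group_hom_axioms_def)

lemma quotient_eq_one_iff: "x \<in> carrier G \<Longrightarrow> H #> x = \<one>\<^bsub>G Mod H\<^esub> \<longleftrightarrow> x \<in> H"
  using coset_join1[of H x] coset_join2[of x H] subset subgroup_axioms by auto

lemma quotient_commute:
  assumes "x \<in> carrier G" "y \<in> carrier G" "commutator G x y \<in> H"
  shows "(H #> x) \<otimes>\<^bsub>G Mod H\<^esub> (H #> y) = (H #> y) \<otimes>\<^bsub>G Mod H\<^esub> (H #> x)"
proof -
  interpret q: group_hom G "G Mod H" "r_coset G H" by (rule group_hom_quotient)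
  show ?thesis
    using assms quotient_eq_one_iff[of "commutator G x y"]
    by (simp add: q.hom_commutator q.H.commutator_eq_one_iff del: mult_FactGroup one_FactGroup)
qed

text \<open>The hypothesis makes the image of \<open>[x, y]\<close> central in the quotient, so the
  power rules apply there. Used in both directions, this moves an exponent from one argument of a
  commutator to the other.\<close>

lemma pow_commutator_mem:
  assumes x: "x \<in> carrier G" and y: "y \<in> carrier G"
    and central: "\<And>g. g \<in> carrier G \<Longrightarrow> commutator G (commutator G x y) g \<in> H"
  shows "commutator G x y [^] (n::nat) \<in> H \<longleftrightarrow> commutator G (x [^] n) y \<in> H"
    and "commutator G x y [^] (n::nat) \<in> H \<longleftrightarrow> commutator G x (y [^] n) \<in> H"
proof -
  interpret q: group_hom G "G Mod H" "r_coset G H" by (rule group_hom_quotient)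
  note [simp del] = mult_FactGroup one_FactGroup
  have *: "(H #> g) \<otimes>\<^bsub>G Mod H\<^esub> (H #> commutator G x y)
      = (H #> commutator G x y) \<otimes>\<^bsub>G Mod H\<^esub> (H #> g)" if "g \<in> carrier G" for g
    using quotient_commute[OF _ that central[OF that]] x y by simp
  have "H #> commutator G (x [^] n) y = H #> (commutator G x y [^] n)"
    using x y *[OF x]
    by (simp add: q.hom_commutator q.hom_nat_pow q.H.commutator_pow_left)
  then show "commutator G x y [^] n \<in> H \<longleftrightarrow> commutator G (x [^] n) y \<in> H"
    using x y quotient_eq_one_iff by (metis commutator_closed nat_pow_closed)
  have "H #> commutator G x (y [^] n) = H #> (commutator G x y [^] n)"
    using x y *[OF y]
    by (simp add: q.hom_commutator q.hom_nat_pow q.H.commutator_pow_right)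
  then show "commutator G x y [^] n \<in> H \<longleftrightarrow> commutator G x (y [^] n) \<in> H"
    using x y quotient_eq_one_iff by (metis commutator_closed nat_pow_closed)
qed

text \<open>The subgroup generated by \<open>Y\<close> has abelian image in the quotient by
  \<open>H\<close>, and in an abelian group taking \<open>m\<close>-th powers is a homomorphism.
  Hence it suffices to check the generators.\<close>

lemma pow_generate_mem:
  assumes Y: "Y \<subseteq> carrier G"
    and comm: "\<And>x y. \<lbrakk>x \<in> generate G Y; y \<in> generate G Y\<rbrakk> \<Longrightarrow> commutator G x y \<in> H"
    and pow: "\<And>y. y \<in> Y \<Longrightarrow> y [^] (m::nat) \<in> H"
    and x: "x \<in> generate G Y"
  shows "x [^] m \<in> H"
  using x
proof (induction rule: generate.induct)
  case (inv y)
  then show ?case using pow Y nat_pow_inv[of y m] by (auto simp: subset_iff)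
next
  case (eng x y)
  interpret q: group_hom G "G Mod H" "r_coset G H" by (rule group_hom_quotient)
  note [simp del] = mult_FactGroup one_FactGroup
  have c: "x \<in> carrier G" "y \<in> carrier G"
    using eng Y generate_in_carrier by blast+
  have "H #> ((x \<otimes> y) [^] m) = \<one>\<^bsub>G Mod H\<^esub>"
    using c eng.IH quotient_eq_one_iff[of "x [^] m"] quotient_eq_one_iff[of "y [^] m"]
      q.H.pow_mult_distrib[OF quotient_commute[OF c comm[OF eng.hyps]]]
    by (simp add: q.hom_nat_pow)
  then show ?case using c quotient_eq_one_iff by simp
qed (use pow in auto)

end

section \<open>The lower central series and powers\<close>

context group
begin

text \<open>A conjugate of \<open>[a, b]\<close> is the commutator of the conjugates, so the
  generating set of the next term is invariant under conjugation.\<close>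

lemma lower_central_normal: "lower_central G n \<lhd> G"
proof (induction n)
  case 0
  show ?case using normal_invI[OF subgroup_self] by simp
next
  case (Suc n)
  then interpret N: normal "lower_central G n" G .
  have "generate G (comm_set G (lower_central G n) (carrier G)) \<lhd> G"
  proof (rule normal_generateI)
    show "comm_set G (lower_central G n) (carrier G) \<subseteq> carrier G"
      using N.subset by (auto simp: comm_set_eq)
    fix h g assume "h \<in> comm_set G (lower_central G n) (carrier G)" and g: "g \<in> carrier G"
    then obtain a b where ab: "h = commutator G a b" "a \<in> lower_central G n" "b \<in> carrier G"
      by (auto simp: comm_set_eq)
    have "a \<in> carrier G" using ab N.subset by auto
    then have "g \<otimes> h \<otimes> inv g = commutator G (g \<otimes> a \<otimes> inv g) (g \<otimes> b \<otimes> inv g)"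
      using ab g by (simp add: commutator_def m_assoc inv_mult_group)
    moreover have "g \<otimes> a \<otimes> inv g \<in> lower_central G n"
      using ab g by (simp add: N.inv_op_closed2)
    ultimately show "g \<otimes> h \<otimes> inv g \<in> comm_set G (lower_central G n) (carrier G)"
      using ab g by (auto simp: comm_set_eq)
  qed
  then show ?case by simp
qed

lemma lower_central_subset: "lower_central G n \<subseteq> carrier G"
  using lower_central_normal normal_imp_subgroup subgroup.subset by blast

lemma comm_set_subset: "comm_set G (lower_central G n) (carrier G) \<subseteq> carrier G"
  using lower_central_subset by (auto simp: comm_set_eq)

lemma commutator_in_lower_central:
  "\<lbrakk>x \<in> lower_central G n; y \<in> carrier G\<rbrakk> \<Longrightarrow> commutator G x y \<in> lower_central G (Suc n)"
  by (auto simp: comm_set_eq intro!: generate.incl)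

lemma commutator_in_normal:
  assumes "N \<lhd> G" "x \<in> N" "y \<in> carrier G"
  shows "commutator G x y \<in> N"
proof -
  interpret N: normal N G by fact
  have "commutator G x y = x \<otimes> (y \<otimes> inv x \<otimes> inv y)"
    using assms N.subset by (auto simp: commutator_def m_assoc)
  then show ?thesis
    using assms by (simp add: N.inv_op_closed2)
qed

lemma lower_central_Suc_subset: "lower_central G (Suc n) \<subseteq> lower_central G n"
proof -
  have "comm_set G (lower_central G n) (carrier G) \<subseteq> lower_central G n"
    using commutator_in_normal[OF lower_central_normal] by (auto simp: comm_set_eq)
  then show ?thesis
    using generate_subgroup_incl[OF _ normal_imp_subgroup[OF lower_central_normal]] by simp
qed

lemma lower_central_trivial_mono:
  assumes "lower_central G n = {\<one>}" "n \<le> m"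
  shows "lower_central G m = {\<one>}"
proof -
  have "lower_central G m \<subseteq> lower_central G n"
    using lower_central_Suc_subset lift_Suc_antimono_le[OF _ assms(2), of "lower_central G"] by auto
  then show ?thesis
    using assms subgroup.one_closed[OF normal_imp_subgroup[OF lower_central_normal]] by auto
qed

text \<open>Every further \<open>m\<close>-th power gains one term of the series. If
  \<open>u\<close> is the current power of \<open>x\<close>, then \<open>[u, z]\<close> is central
  modulo the next term, so \<open>[u^m, z]\<close> agrees there with \<open>[u, z^m]\<close>, which
  is trivial.\<close>

lemma commutator_pow_in_lower_central:
  assumes "x \<in> carrier G" "z \<in> carrier G" "z [^] (m::nat) = \<one>"
  shows "commutator G (x [^] (m ^ k)) z \<in> lower_central G (Suc k)"
proof (induction k)
  case 0
  then show ?case using assms commutator_in_lower_central[of x 0 z] by simp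
next
  case (Suc k)
  interpret N: normal "lower_central G (Suc (Suc k))" G by (rule lower_central_normal)
  let ?u = "x [^] (m ^ k)"
  have "commutator G ?u (z [^] m) \<in> lower_central G (Suc (Suc k))"
    using assms N.one_closed by (simp add: commutator_def del: lower_central.simps)
  then have "commutator G (?u [^] m) z \<in> lower_central G (Suc (Suc k))"
    using N.pow_commutator_mem[of ?u z m] assms commutator_in_lower_central[OF Suc]
    by blast
  then show ?case
    using assms by (simp add: nat_pow_pow mult.commute del: lower_central.simps)
qed

text \<open>The exponent depends only on \<open>m\<close> and \<open>c\<close>, not on
  \<open>x\<close>. Later \<open>x\<close> is therefore chosen after \<open>z\<close>, as a root of
  sufficiently high degree.\<close>

lemma pow_commutes_with_torsion:
  assumes "lower_central G c = {\<one>}"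
    and "x \<in> carrier G" "z \<in> carrier G" "z [^] (m::nat) = \<one>"
  shows "x [^] (m ^ c) \<otimes> z = z \<otimes> x [^] (m ^ c)"
  using commutator_pow_in_lower_central[OF assms(2-4), of c]
    lower_central_trivial_mono[OF assms(1), of "Suc c"] assms commutator_eq_one_iff by auto

text \<open>Induction on \<open>i\<close>: a generator \<open>[a, b]\<close> of the next term
  satisfies \<open>[a, b]^m = [a^m, b]\<close> modulo the term after it, and \<open>a^m\<close> has
  already dropped one term. At the bottom, generators killed by \<open>m\<close> give an
  abelianization of exponent dividing \<open>m\<close>.\<close>

lemma pow_in_lower_central_Suc:
  assumes B: "B \<subseteq> carrier G" and gen: "carrier G = generate G B"
    and pow: "\<And>x. x \<in> B \<Longrightarrow> x [^] (m::nat) = \<one>"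
    and x: "x \<in> lower_central G i"
  shows "x [^] m \<in> lower_central G (Suc i)"
  using x
proof (induction i arbitrary: x)
  case 0
  interpret N: normal "lower_central G (Suc 0)" G by (rule lower_central_normal)
  show ?case
  proof (rule N.pow_generate_mem[OF B])
    show "x \<in> generate G B" using 0 gen by simp
    show "commutator G x y \<in> lower_central G (Suc 0)" if "x \<in> generate G B" "y \<in> generate G B" for x y
      using commutator_in_lower_central[of x 0 y] that gen by simp
    show "y [^] m \<in> lower_central G (Suc 0)" if "y \<in> B" for y
      using pow[OF that] N.one_closed by argo
  qed
next
  case (Suc i)
  interpret N: normal "lower_central G (Suc (Suc i))" G by (rule lower_central_normal)
  let ?Y = "comm_set G (lower_central G i) (carrier G)"
  show ?case
  proof (rule N.pow_generate_mem[OF comm_set_subset])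
    show "x \<in> generate G ?Y" using Suc.prems by simp
    show "commutator G x y \<in> lower_central G (Suc (Suc i))" if "x \<in> generate G ?Y" "y \<in> generate G ?Y" for x y
    proof (rule commutator_in_lower_central)
      show "x \<in> lower_central G (Suc i)" using that by simp
      show "y \<in> carrier G" using that generate_in_carrier[OF comm_set_subset] by blast
    qed
    fix y assume "y \<in> ?Y"
    then obtain a b where ab: "y = commutator G a b" "a \<in> lower_central G i" "b \<in> carrier G"
      unfolding comm_set_eq by blast
    then have a: "a \<in> carrier G" using lower_central_subset by blast
    have "commutator G (a [^] m) b \<in> lower_central G (Suc (Suc i))"
      using commutator_in_lower_central[OF Suc.IH[OF ab(2)] ab(3)] .
    then show "y [^] m \<in> lower_central G (Suc (Suc i))"
      unfolding ab(1)
      using N.pow_commutator_mem(1)[OF a ab(3)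
          commutator_in_lower_central[OF commutator_in_lower_central[OF ab(2,3)]]] by blast
  qed
qed

lemma pow_pow_in_lower_central:
  assumes "\<And>i x. x \<in> lower_central G i \<Longrightarrow> x [^] (m::nat) \<in> lower_central G (Suc i)"
    and "x \<in> carrier G"
  shows "x [^] (m ^ i) \<in> lower_central G i"
proof (induction i)
  case (Suc i)
  have "x [^] (m ^ Suc i) = (x [^] (m ^ i)) [^] m"
    using assms(2) by (simp add: nat_pow_pow mult.commute)
  then show ?case using assms(1)[OF Suc] by argo
qed (use assms in simp)

lemma lower_central_subgroup_subset:
  assumes H: "subgroup H G"
  shows "lower_central (G\<lparr>carrier := H\<rparr>) i \<subseteq> lower_central G i"
proof (induction i)
  case 0
  then show ?case using subgroup.subset[OF H] by simp
next
  case (Suc i)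
  let ?H = "G\<lparr>carrier := H\<rparr>"
  interpret H: group ?H using H by (rule subgroup_imp_group)
  have "comm_set ?H (lower_central ?H i) H \<subseteq> comm_set G (lower_central G i) (carrier G)"
  proof
    fix y assume "y \<in> comm_set ?H (lower_central ?H i) H"
    then obtain a b where ab: "y = commutator ?H a b" "a \<in> lower_central ?H i" "b \<in> H"
      by (auto simp: comm_set_eq)
    have "a \<in> H" using ab H.lower_central_subset by auto
    then have "y = commutator G a b" using ab H by (simp add: commutator_def m_inv_consistent)
    then show "y \<in> comm_set G (lower_central G i) (carrier G)"
      using ab Suc subgroup.subset[OF H] by (auto simp: comm_set_eq)
  qed
  moreover have "comm_set ?H (lower_central ?H i) H \<subseteq> H"
    using H.comm_set_subset[of i] by simp
  ultimately show ?case
    using generate_consistent[OF _ H] mono_generate by simp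
qed

text \<open>The argument takes place in the subgroup generated by \<open>a\<close> and
  \<open>b\<close>. Its generators are killed by \<open>m\<close>, so each \<open>m\<close>-th power
  drops one term of its own lower central series, which lies inside that of \<open>G\<close> and is
  trivial after \<open>c\<close> steps.\<close>

lemma mult_pow_eq_one:
  assumes c: "lower_central G c = {\<one>}"
    and ab: "a \<in> carrier G" "b \<in> carrier G" "a [^] (m::nat) = \<one>" "b [^] m = \<one>"
  shows "(a \<otimes> b) [^] (m ^ c) = \<one>"
proof -
  let ?S = "generate G {a, b}"
  let ?H = "G\<lparr>carrier := ?S\<rparr>"
  have S: "subgroup ?S G" using ab by (intro generate_is_subgroup) auto
  interpret H: group ?H using S by (rule subgroup_imp_group)
  have inc: "{a, b} \<subseteq> ?S" by (auto intro: generate.incl)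
  have "a \<otimes> b \<in> ?S" using S inc by (simp add: subgroup.m_closed)
  moreover have "x [^]\<^bsub>?H\<^esub> m \<in> lower_central ?H (Suc i)" if "x \<in> lower_central ?H i" for i x
  proof (rule H.pow_in_lower_central_Suc[of "{a, b}"])
    show "{a, b} \<subseteq> carrier ?H" "carrier ?H = generate ?H {a, b}"
      using inc generate_consistent[OF inc S] by simp_all
    show "x [^]\<^bsub>?H\<^esub> m = \<one>\<^bsub>?H\<^esub>" if "x \<in> {a, b}" for x
      using that ab by (auto simp flip: nat_pow_consistent)
  qed (rule that)
  ultimately have "(a \<otimes> b) [^]\<^bsub>?H\<^esub> (m ^ c) \<in> lower_central ?H c"
    by (intro H.pow_pow_in_lower_central) auto
  then show ?thesis
    using lower_central_subgroup_subset[OF S, of c] c by (simp flip: nat_pow_consistent) auto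
qed

end

section \<open>Elements of infinite height\<close>

text \<open>For abelian groups this is the first Ulm subgroup. The roots are sought in
  \<open>G\<close> and may lie outside the set, so it need not be divisible itself.\<close>

definition divisible_part :: "('a,'b) monoid_scheme \<Rightarrow> 'a set" where
  "divisible_part G = {g \<in> carrier G. \<forall>n::nat. n \<ge> 1 \<longrightarrow> (\<exists>h\<in>carrier G. g = h [^]\<^bsub>G\<^esub> n)}"

lemma prime_power_decompose:
  assumes "Factorial_Ring.prime (p::nat)" "n \<ge> 1"
  obtains m s where "n = m * p ^ s" "\<not> p dvd m"
  using multiplicity_decompose'[of n p] assms
  by (metis mult.commute not_one_le_zero not_prime_unit)

lemma bezout_prime_power:
  assumes p: "Factorial_Ring.prime (p::nat)" and n: "\<not> p dvd n"
  obtains x y where "n * x = p ^ k * y + 1"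
proof -
  have "n \<noteq> 0" using n by (metis dvd_0_right)
  moreover have "coprime n (p ^ k)" using prime_imp_coprime[OF p n] by (simp add: coprime_commute)
  ultimately show thesis using bezout_nat[of n "p ^ k"] that by auto
qed

text \<open>Here \<open>c\<close> is any bound on the nilpotency class; fixing it makes exponents
  such as \<open>m ^ c\<close> explicit.\<close>

locale periodic_nilpotent = group G for G :: "('a,'b) monoid_scheme" (structure) +
  fixes c :: nat
  assumes lower_central_c: "lower_central G c = {\<one>}"
    and periodic: "\<And>g. g \<in> carrier G \<Longrightarrow> \<exists>n::nat. n \<ge> 1 \<and> g [^] n = \<one>"
begin

abbreviation D where "D \<equiv> divisible_part G"

lemma divisible_partD:
  "\<lbrakk>g \<in> D; (n::nat) \<ge> 1\<rbrakk> \<Longrightarrow> \<exists>h\<in>carrier G. g = h [^] n"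
  by (simp add: divisible_part_def)

lemma divisible_part_subset: "D \<subseteq> carrier G"
  by (auto simp: divisible_part_def)

text \<open>If \<open>m\<close> kills \<open>z\<close>, an \<open>m ^ c\<close>-th power commutes
  with \<open>z\<close>, and \<open>g\<close> is such a power.\<close>

lemma divisible_part_central:
  assumes "g \<in> D" "z \<in> carrier G"
  shows "g \<otimes> z = z \<otimes> g"
proof -
  obtain m :: nat where m: "m \<ge> 1" "z [^] m = \<one>" using periodic assms by blast
  then obtain h where "h \<in> carrier G" "g = h [^] (m ^ c)"
    using divisible_partD[OF assms(1), of "m ^ c"] by auto
  then show ?thesis
    using pow_commutes_with_torsion[OF lower_central_c _ assms(2) m(2)] by simp
qed

text \<open>Roots of \<open>a\<close> and \<open>b\<close> multiply once they commute. The
  \<open>n\<close>-th root \<open>k\<close> of \<open>b\<close> is fixed first; then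
  \<open>a\<close> is written as an \<open>n\<close>-th power of an \<open>m ^ c\<close>-th power,
  where \<open>m\<close> kills \<open>k\<close>.\<close>

lemma divisible_part_mult:
  assumes "a \<in> D" "b \<in> D"
  shows "a \<otimes> b \<in> D"
proof -
  have "\<exists>h\<in>carrier G. a \<otimes> b = h [^] n" if n: "n \<ge> 1" for n :: nat
  proof -
    obtain k where k: "k \<in> carrier G" "b = k [^] n" using divisible_partD[OF assms(2) n] by auto
    obtain m :: nat where m: "m \<ge> 1" "k [^] m = \<one>" using periodic k by blast
    then obtain h where h: "h \<in> carrier G" "a = h [^] (m ^ c * n)"
      using divisible_partD[OF assms(1), of "m ^ c * n"] n by auto
    let ?u = "h [^] (m ^ c)"
    have "?u \<otimes> k = k \<otimes> ?u"
      using pow_commutes_with_torsion[OF lower_central_c h(1) k(1) m(2)] .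
    then have "(?u \<otimes> k) [^] n = ?u [^] n \<otimes> k [^] n"
      using h k by (intro pow_mult_distrib) auto
    then have "a \<otimes> b = (?u \<otimes> k) [^] n" using h k by (simp add: nat_pow_pow)
    then show ?thesis using h k by blast
  qed
  then show ?thesis using assms by (auto simp: divisible_part_def)
qed

lemma divisible_part_subgroup: "subgroup D G"
proof
  fix x assume x: "x \<in> D"
  have "\<exists>h\<in>carrier G. inv x = h [^] n" if "n \<ge> 1" for n :: nat
    using divisible_partD[OF x that] by (metis inv_closed nat_pow_inv)
  then show "inv x \<in> D" using x by (auto simp: divisible_part_def)
next
  show "\<one> \<in> D" by (auto simp: divisible_part_def intro!: bexI[of _ \<one>])
qed (use divisible_part_mult divisible_part_subset in auto)

lemma p_component_subgroup: "subgroup (p_component G p) G"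
proof
  fix a b assume "a \<in> p_component G p" "b \<in> p_component G p"
  then obtain k l :: nat where ab: "a \<in> carrier G" "b \<in> carrier G"
    and kl: "a [^] (p ^ k) = \<one>" "b [^] (p ^ l) = \<one>"
    by (auto simp: p_component_def)
  \<comment> \<open>A common exponent for both elements that is still a power of \<open>p\<close>;
    its \<open>c\<close>-th power then kills the product.\<close>
  have "a [^] (p ^ (k + l)) = \<one>" "b [^] (p ^ (k + l)) = \<one>"
    using ab kl nat_pow_pow[of a "p ^ k" "p ^ l"] nat_pow_pow[of b "p ^ l" "p ^ k"]
    by (metis nat_pow_one power_add, metis nat_pow_one power_add mult.commute)
  then have "(a \<otimes> b) [^] (p ^ ((k + l) * c)) = \<one>"
    using mult_pow_eq_one[OF lower_central_c ab] by (metis power_mult)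
  then show "a \<otimes> b \<in> p_component G p" using ab by (auto simp: p_component_def)
next
  show "p_component G p \<subseteq> carrier G" "\<one> \<in> p_component G p" by (auto simp: p_component_def)
next
  fix a assume "a \<in> p_component G p"
  then show "inv a \<in> p_component G p"
    by (auto simp: p_component_def nat_pow_inv)
qed

text \<open>\<open>n\<close> is invertible modulo the order of \<open>g\<close>, a power of
  \<open>p\<close>, so the root can be taken among the powers of \<open>g\<close>.\<close>

lemma p_component_coprime_root:
  assumes p: "Factorial_Ring.prime (p::nat)" and g: "g \<in> p_component G p"
    and n: "\<not> p dvd n"
  obtains u :: nat where "g = (g [^] u) [^] n"
proof -
  from g obtain k :: nat where k: "g \<in> carrier G" "g [^] (p ^ k) = \<one>"
    by (auto simp: p_component_def)
  obtain x y where xy: "n * x = p ^ k * y + 1"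
    using bezout_prime_power[OF p n] .
  have "(g [^] x) [^] n = g [^] (p ^ k * y + 1)"
    using k xy by (simp add: nat_pow_pow mult.commute)
  also have "\<dots> = g"
    using k by (simp flip: nat_pow_mult nat_pow_pow)
  finally show ?thesis using that by metis
qed

text \<open>Two gaps are closed. Roots of degree prime to \<open>p\<close> exist automatically in
  the \<open>p\<close>-component, so roots of degree \<open>p ^ n\<close> give all roots; and a root
  taken in \<open>G\<close> can be replaced by one inside the component.\<close>

lemma infinite_height_part_eq:
  assumes p: "Factorial_Ring.prime (p::nat)"
  shows "infinite_height_part (p_component_group G p) p = D \<inter> p_component G p"
proof -
  let ?P = "p_component G p"
  have "g \<in> D" if g: "g \<in> ?P" and ht: "\<And>n. \<exists>h\<in>?P. g = h [^] (p ^ n)" for g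
  proof -
    have "\<exists>h\<in>carrier G. g = h [^] n" if n1: "n \<ge> 1" for n :: nat
    proof -
      obtain m s where n: "n = m * p ^ s" "\<not> p dvd m"
        using prime_power_decompose[OF p n1] .
      obtain h where h: "h \<in> ?P" "g = h [^] (p ^ s)" using ht by blast
      obtain u :: nat where u: "h = (h [^] u) [^] m"
        using p_component_coprime_root[OF p h(1) n(2)] .
      have hc: "h \<in> carrier G" using h by (auto simp: p_component_def)
      have "g = (h [^] u) [^] n"
        using hc h(2) u n(1) by (metis nat_pow_closed nat_pow_pow)
      then show ?thesis using hc by blast
    qed
    then show ?thesis using g by (auto simp: divisible_part_def p_component_def)
  qed
  moreover have "\<exists>h\<in>?P. g = h [^] (p ^ n)" if gD: "g \<in> D" and gP: "g \<in> ?P" for g n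
  proof -
    obtain h where h: "h \<in> carrier G" "g = h [^] (p ^ n)"
      using divisible_partD[OF gD, of "p ^ n"] p prime_gt_0_nat by (metis One_nat_def Suc_leI zero_less_power)
    obtain N :: nat where N: "N \<ge> 1" "h [^] N = \<one>" using periodic h by blast
    obtain m a where ma: "N = m * p ^ a" "\<not> p dvd m"
      using prime_power_decompose[OF p N(1)] .
    obtain u :: nat where u: "g = (g [^] u) [^] m"
      using p_component_coprime_root[OF p gP ma(2)] .
    \<comment> \<open>The exponent \<open>m\<close>, the part prime to \<open>p\<close> of an
      exponent killing \<open>h\<close>, moves the root into the \<open>p\<close>-component;
      \<open>u\<close> undoes its effect on \<open>g\<close>.\<close>
    let ?h = "h [^] (u * m)"
    have "?h [^] (p ^ a) = (h [^] N) [^] u"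
      using h(1) ma by (simp add: nat_pow_pow ac_simps)
    then have "?h \<in> ?P" using h N by (auto simp: p_component_def)
    moreover have "g = ?h [^] (p ^ n)"
      using u h by (simp add: nat_pow_pow ac_simps)
    ultimately show ?thesis by blast
  qed
  ultimately show ?thesis
    by (auto simp: infinite_height_part_def p_component_group_def simp flip: nat_pow_consistent)
qed

section \<open>The Ulm condition as boundedness modulo the divisible part\<close>

lemma
  assumes p: "Factorial_Ring.prime (p::nat)"
  shows nontrivial_first_ulm_factor_iff:
      "nontrivial_group (first_ulm_factor (p_component_group G p) p) \<longleftrightarrow> \<not> p_component G p \<subseteq> D"
    and bounded_first_ulm_factor_iff:
      "bounded_period (first_ulm_factor (p_component_group G p) p) \<longleftrightarrow>
        (\<exists>n::nat. n \<ge> 1 \<and> (\<forall>g\<in>p_component G p. g [^] n \<in> D))"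
proof -
  let ?P = "p_component G p"
  let ?H = "p_component_group G p"
  let ?K = "D \<inter> ?P"
  have Pc: "?P \<subseteq> carrier G" by (auto simp: p_component_def)
  interpret P: group ?H
    unfolding p_component_group_def using p_component_subgroup by (rule subgroup_imp_group)
  have "subgroup ?K ?H"
    unfolding p_component_group_def
    by (intro subgroup_incl subgroups_Inter_pair divisible_part_subgroup p_component_subgroup) auto
  then interpret K: normal ?K ?H
  proof (rule P.normal_invI)
    fix x h assume x: "x \<in> carrier ?H" and h: "h \<in> ?K"
    then have xc: "x \<in> carrier G" "h \<in> carrier G" using Pc by (auto simp: p_component_group_def)
    have "x \<otimes> h \<otimes> inv x = h"
      using xc h divisible_part_central[of h x] by (simp add: m_assoc flip: divisible_part_central)
    then show "x \<otimes>\<^bsub>?H\<^esub> h \<otimes>\<^bsub>?H\<^esub> inv\<^bsub>?H\<^esub> x \<in> ?K"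
      using x h m_inv_consistent[OF p_component_subgroup] by (simp add: p_component_group_def)
  qed
  interpret q: group_hom ?H "?H Mod ?K" "r_coset ?H ?K" by (rule K.group_hom_quotient)
  have F: "first_ulm_factor ?H p = ?H Mod ?K"
    by (simp add: first_ulm_factor_def infinite_height_part_eq[OF p])
  have cP: "carrier ?H = ?P" by (simp add: p_component_group_def)
  have carr: "carrier (?H Mod ?K) = (\<lambda>x. ?K #>\<^bsub>?H\<^esub> x) ` ?P"
    by (simp add: carrier_FactGroup cP)
  have "carrier (?H Mod ?K) = {\<one>\<^bsub>?H Mod ?K\<^esub>} \<longleftrightarrow> (\<forall>x\<in>?P. ?K #>\<^bsub>?H\<^esub> x = \<one>\<^bsub>?H Mod ?K\<^esub>)"
    unfolding carr using P.one_closed cP by blast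
  also have "\<dots> \<longleftrightarrow> ?P \<subseteq> D"
    using K.quotient_eq_one_iff cP by (auto simp del: one_FactGroup)
  finally show "nontrivial_group (first_ulm_factor ?H p) \<longleftrightarrow> \<not> ?P \<subseteq> D"
    unfolding F nontrivial_group_def by blast
  have "(?K #>\<^bsub>?H\<^esub> g) [^]\<^bsub>?H Mod ?K\<^esub> n = \<one>\<^bsub>?H Mod ?K\<^esub> \<longleftrightarrow> g [^] n \<in> D" if "g \<in> ?P" for g and n :: nat
  proof -
    have "g [^]\<^bsub>?H\<^esub> n = g [^] n" by (simp add: p_component_group_def flip: nat_pow_consistent)
    moreover have "(?K #>\<^bsub>?H\<^esub> g) [^]\<^bsub>?H Mod ?K\<^esub> n = ?K #>\<^bsub>?H\<^esub> (g [^]\<^bsub>?H\<^esub> n)"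
      using that cP by (simp add: q.hom_nat_pow)
    moreover have "g [^]\<^bsub>?H\<^esub> n \<in> ?P" using P.nat_pow_closed that cP by blast
    ultimately show ?thesis
      using K.quotient_eq_one_iff[of "g [^]\<^bsub>?H\<^esub> n"] cP by (simp del: one_FactGroup)
  qed
  then show "bounded_period (first_ulm_factor ?H p) \<longleftrightarrow> (\<exists>n::nat. n \<ge> 1 \<and> (\<forall>g\<in>?P. g [^] n \<in> D))"
    unfolding F bounded_period_def carr by blast
qed

text \<open>Strong induction on an exponent \<open>m\<close> killing \<open>g\<close>: for a prime
  \<open>p\<close> dividing \<open>m\<close>, the \<open>p\<close>-part of \<open>g\<close> is split
  off, and what remains is killed by a smaller exponent.\<close>

lemma bounded_mod_divisible_part_if_components:
  assumes K: "\<And>p g. \<lbrakk>Factorial_Ring.prime p; g \<in> p_component G p\<rbrakk> \<Longrightarrow> g [^] (K::nat) \<in> D"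
    and g: "g \<in> carrier G"
  shows "g [^] K \<in> D"
proof -
  interpret D: subgroup D G by (rule divisible_part_subgroup)
  have "g [^] K \<in> D" if "g \<in> carrier G" "m \<ge> 1" "g [^] m = \<one>" for g and m :: nat
    using that
  proof (induction m arbitrary: g rule: less_induct)
    case (less m)
    show ?case
    proof (cases "m = 1")
      case True
      then show ?thesis using less.prems by simp
    next
      case False
      then obtain p where p: "Factorial_Ring.prime p" "p dvd m" using prime_factor_nat by blast
      obtain n a where na: "m = n * p ^ a" "\<not> p dvd n"
        using prime_power_decompose[OF p(1) less.prems(2)] .
      have "a \<noteq> 0" using na p by (cases a) auto
      then have "1 < p ^ a" using p prime_gt_1_nat by (intro one_less_power) auto
      moreover have n0: "n \<noteq> 0" using na(2) by (metis dvd_0_right)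
      ultimately have lt: "n < m" using na by simp
      obtain x y where xy: "n * x = p ^ a * y + 1"
        using bezout_prime_power[OF p(1) na(2)] .
      \<comment> \<open>\<open>?d\<close> lies in the \<open>p\<close>-component and
        \<open>?b\<close> is killed by \<open>n\<close>. The Bezout relation gives
        \<open>g = inv ?b \<otimes> ?d\<close>, and the factors commute because both are powers of
        \<open>g\<close>.\<close>
      let ?b = "g [^] (p ^ a * y)" and ?d = "g [^] (n * x)"
      have gc: "g \<in> carrier G" by fact
      have "g = inv ?b \<otimes> ?d"
        using gc xy by (simp flip: nat_pow_mult)
      moreover have "inv ?b \<otimes> ?d = ?d \<otimes> inv ?b"
      proof -
        have "?d = g \<otimes> ?b" using gc xy nat_pow_Suc2[of g "p ^ a * y"] by simp
        then show ?thesis using gc \<open>g = inv ?b \<otimes> ?d\<close> by (simp add: m_assoc)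
      qed
      ultimately have "g [^] K = inv ?b [^] K \<otimes> ?d [^] K"
        using gc pow_mult_distrib[of "inv ?b" ?d K] by simp
      moreover have "?b [^] K \<in> D"
      proof (rule less.IH[OF lt])
        have "?b [^] n = (g [^] m) [^] y" using gc na by (simp add: nat_pow_pow ac_simps)
        then show "?b [^] n = \<one>" using less.prems by simp
      qed (use gc n0 in auto)
      moreover have "?d [^] K \<in> D"
      proof (rule K[OF p(1)])
        have "?d [^] (p ^ a) = (g [^] m) [^] x" using gc na by (simp add: nat_pow_pow ac_simps)
        then show "?d \<in> p_component G p" using less.prems by (auto simp: p_component_def)
      qed
      ultimately show ?thesis using gc by (simp add: nat_pow_inv)
    qed
  qed
  then show ?thesis using periodic g by blast
qed

text \<open>Left to right, the bounds of the finitely many exceptional components are multiplied;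
  the other components lie in \<open>D\<close>. Conversely, a prime \<open>p\<close> not dividing
  \<open>K\<close> is not exceptional, since every element of its component is a \<open>K\<close>-th
  power; so the exceptional primes are divisors of \<open>K\<close>.\<close>

theorem ulm_condition_iff:
  "(finite {p::nat. Factorial_Ring.prime p \<and> nontrivial_group (first_ulm_factor (p_component_group G p) p)} \<and>
      (\<forall>p::nat. Factorial_Ring.prime p \<and> nontrivial_group (first_ulm_factor (p_component_group G p) p)
          \<longrightarrow> bounded_period (first_ulm_factor (p_component_group G p) p)))
   \<longleftrightarrow> (\<exists>K::nat. K \<ge> 1 \<and> (\<forall>g\<in>carrier G. g [^] K \<in> D))" (is "?L \<longleftrightarrow> ?R")
proof -
  interpret D: subgroup D G by (rule divisible_part_subgroup)
  have Dpow: "x [^] n \<in> D" if "x \<in> D" for x and n :: nat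
    using that by (induction n) auto
  let ?S = "{p::nat. Factorial_Ring.prime p \<and> \<not> p_component G p \<subseteq> D}"
  have eq: "?L \<longleftrightarrow> finite ?S \<and> (\<forall>p\<in>?S. \<exists>n::nat. n \<ge> 1 \<and> (\<forall>g\<in>p_component G p. g [^] n \<in> D))"
    using nontrivial_first_ulm_factor_iff bounded_first_ulm_factor_iff by (simp cong: conj_cong)
  have "?R" if fin: "finite ?S" and ex: "\<forall>p\<in>?S. \<exists>n::nat. n \<ge> 1 \<and> (\<forall>g\<in>p_component G p. g [^] n \<in> D)"
  proof -
    obtain f :: "nat \<Rightarrow> nat" where f: "\<And>p. p \<in> ?S \<Longrightarrow> f p \<ge> 1 \<and> (\<forall>g\<in>p_component G p. g [^] f p \<in> D)"
      using bchoice[OF ex] by blast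
    let ?K = "\<Prod>p\<in>?S. f p"
    have "g [^] ?K \<in> D" if p: "Factorial_Ring.prime p" "g \<in> p_component G p" for p g
    proof (cases "p \<in> ?S")
      case True
      then obtain l where l: "?K = f p * l" using fin by (meson dvd_prodI dvdE)
      have "g \<in> carrier G" using p by (auto simp: p_component_def)
      then have "g [^] ?K = (g [^] f p) [^] l" by (simp add: l nat_pow_pow)
      then show ?thesis using f[OF True] p Dpow by simp
    next
      case False
      then show ?thesis using p Dpow by blast
    qed
    then have "\<forall>g\<in>carrier G. g [^] ?K \<in> D"
      using bounded_mod_divisible_part_if_components by blast
    moreover have "?K \<ge> 1" using f by (intro prod_ge_1) auto
    ultimately show ?R by blast
  qed
  moreover have "finite ?S \<and> (\<forall>p\<in>?S. \<exists>n::nat. n \<ge> 1 \<and> (\<forall>g\<in>p_component G p. g [^] n \<in> D))" if R: ?R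
  proof -
    obtain K :: nat where K: "K \<ge> 1" "\<And>g. g \<in> carrier G \<Longrightarrow> g [^] K \<in> D" using R by blast
    have "?S \<subseteq> {p. p dvd K}"
    proof (intro subsetI CollectI)
      fix p assume p: "p \<in> ?S"
      then obtain g where g: "g \<in> p_component G p" "g \<notin> D" by blast
      show "p dvd K"
      proof (rule ccontr)
        assume "\<not> p dvd K"
        then obtain u :: nat where "g = (g [^] u) [^] K"
          using p_component_coprime_root[of p g K] p g by blast
        then show False using K(2)[of "g [^] u"] g by (auto simp: p_component_def)
      qed
    qed
    then have "finite ?S" using K finite_subset[OF _ finite_divisors_nat[of K]] by simp
    moreover have "\<forall>g\<in>p_component G p. g [^] K \<in> D" for p
      using K by (auto simp: p_component_def)
    ultimately show ?thesis using K(1) by blast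
  qed
  ultimately show ?thesis unfolding eq by blast
qed

end

section \<open>Extending homomorphisms\<close>

text \<open>The graph of a homomorphism from a subgroup of \<open>\<int>\<^sup>J\<close> to \<open>G\<close>.\<close>
definition partial_hom :: "('a,'b) monoid_scheme \<Rightarrow> (('j \<Rightarrow> int) \<times> 'a) set \<Rightarrow> bool" where
  "partial_hom G T \<longleftrightarrow> T \<noteq> {} \<and> snd ` T \<subseteq> carrier G \<and>
     (\<forall>u a v b. (u, a) \<in> T \<longrightarrow> (v, b) \<in> T \<longrightarrow> ((\<lambda>j. u j - v j), a \<otimes>\<^bsub>G\<^esub> inv\<^bsub>G\<^esub> b) \<in> T) \<and>
     (\<forall>a. ((\<lambda>j. 0), a) \<in> T \<longrightarrow> a = \<one>\<^bsub>G\<^esub>)"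

context comm_group
begin

lemma partial_homD:
  assumes "partial_hom G T"
  shows partial_hom_closed: "(u, a) \<in> T \<Longrightarrow> a \<in> carrier G"
    and partial_hom_diff: "\<lbrakk>(u, a) \<in> T; (v, b) \<in> T\<rbrakk> \<Longrightarrow> ((\<lambda>j. u j - v j), a \<otimes> inv b) \<in> T"
    and partial_hom_zero: "((\<lambda>j. 0), a) \<in> T \<Longrightarrow> a = \<one>"
  using assms by (force simp: partial_hom_def)+

lemma partial_hom_zero_mem:
  assumes T: "partial_hom G T"
  shows "((\<lambda>j. 0), \<one>) \<in> T"
proof -
  obtain u a where ua: "(u, a) \<in> T" using T by (auto simp: partial_hom_def)
  then show ?thesis using partial_hom_diff[OF T ua ua] partial_hom_closed[OF T ua] by simp
qed

lemma partial_hom_neg: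
  assumes T: "partial_hom G T" and u: "(u, a) \<in> T"
  shows "((\<lambda>j. - u j), inv a) \<in> T"
  using partial_hom_diff[OF T partial_hom_zero_mem[OF T] u] partial_hom_closed[OF T u] by simp

lemma partial_hom_add:
  assumes T: "partial_hom G T" and u: "(u, a) \<in> T" and v: "(v, b) \<in> T"
  shows "((\<lambda>j. u j + v j), a \<otimes> b) \<in> T"
  using partial_hom_diff[OF T u partial_hom_neg[OF T v]] partial_hom_closed[OF T v] by simp

lemma partial_hom_unique:
  assumes T: "partial_hom G T" and u: "(u, a) \<in> T" "(u, b) \<in> T"
  shows "a = b"
proof -
  have "a \<otimes> inv b = \<one>"
    using partial_hom_diff[OF T u] by (intro partial_hom_zero[OF T]) simp
  then show ?thesis using partial_hom_closed[OF T] u by (metis inv_comm inv_equality inv_inv inv_closed)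
qed

lemma partial_hom_scale:
  assumes T: "partial_hom G T" and u: "(u, a) \<in> T"
  shows "((\<lambda>j. n * u j), a [^] (n::int)) \<in> T"
proof -
  have *: "((\<lambda>j. int k * u j), a [^] k) \<in> T" for k :: nat
  proof (induction k)
    case (Suc k)
    then show ?case
      using partial_hom_add[OF T Suc u] by (simp add: algebra_simps)
  qed (use partial_hom_zero_mem[OF T] in simp)
  show ?thesis
  proof (cases "n \<ge> 0")
    case True
    then show ?thesis using *[of "nat n"] by (simp flip: int_pow_int)
  next
    case False
    then have n: "n = - int (nat (- n))" by simp
    have "((\<lambda>j. - (int (nat (- n)) * u j)), inv (a [^] nat (- n))) \<in> T"
      using partial_hom_neg[OF T *] .
    then show ?thesis
      using False partial_hom_closed[OF T u]
      by (subst n, subst int_pow_neg_int) (auto simp: minus_mult_left[symmetric])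
  qed
qed

text \<open>\<open>T'\<close> is the graph on the span of the domain and \<open>v\<close>, with
  \<open>a\<close> as the value at \<open>v\<close>. The hypothesis \<open>compat\<close> says that
  \<open>a\<close> agrees with the values already given to multiples of \<open>v\<close>, which is
  exactly well-definedness.\<close>

lemma partial_hom_extend_by_one:
  assumes T: "partial_hom G T" and a: "a \<in> carrier G"
    and compat: "\<And>n b. ((\<lambda>j. n * v j), b) \<in> T \<Longrightarrow> b = a [^] (n::int)"
  shows "\<exists>T'. partial_hom G T' \<and> T \<subseteq> T' \<and> v \<in> Domain T'"
proof -
  define T' where "T' = {((\<lambda>j. u j + n * v j), b \<otimes> a [^] n) | u b n. (u, b) \<in> T}"
  note cl = partial_hom_closed[OF T]
  have "T \<subseteq> T'"
  proof
    fix x assume "x \<in> T"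
    then obtain u b where ub: "x = (u, b)" "(u, b) \<in> T" by (cases x) auto
    then have "x = ((\<lambda>j. u j + 0 * v j), b \<otimes> a [^] (0::int))"
      using cl by simp
    then show "x \<in> T'" unfolding T'_def using ub by blast
  qed
  moreover have "v \<in> Domain T'"
  proof -
    have "((\<lambda>j. 0 + 1 * v j), \<one> \<otimes> a [^] (1::int)) \<in> T'"
      unfolding T'_def using partial_hom_zero_mem[OF T]
      by (intro CollectI exI[of _ "\<lambda>j. 0"] exI[of _ \<one>] exI[of _ 1]) simp
    then show ?thesis by auto
  qed
  moreover have "partial_hom G T'"
    unfolding partial_hom_def
  proof (intro conjI allI impI)
    show "T' \<noteq> {}" using \<open>v \<in> Domain T'\<close> by auto
    show "snd ` T' \<subseteq> carrier G" using cl a by (auto simp: T'_def)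
  next
    fix u b v' b' assume "(u, b) \<in> T'" "(v', b') \<in> T'"
    then obtain u1 b1 n1 u2 b2 n2 where *: "(u1, b1) \<in> T" "(u2, b2) \<in> T"
      "u = (\<lambda>j. u1 j + n1 * v j)" "b = b1 \<otimes> a [^] n1" "v' = (\<lambda>j. u2 j + n2 * v j)" "b' = b2 \<otimes> a [^] n2"
      by (auto simp: T'_def)
    have "b \<otimes> inv b' = (b1 \<otimes> inv b2) \<otimes> a [^] (n1 - n2)"
      using * cl a by (simp add: int_pow_diff inv_mult m_ac)
    moreover have "(\<lambda>j. u j - v' j) = (\<lambda>j. (u1 j - u2 j) + (n1 - n2) * v j)"
      using * by (auto simp: algebra_simps)
    ultimately show "((\<lambda>j. u j - v' j), b \<otimes> inv b') \<in> T'"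
      unfolding T'_def using partial_hom_diff[OF T *(1,2)]
      by (intro CollectI exI[of _ "\<lambda>j. u1 j - u2 j"] exI[of _ "b1 \<otimes> inv b2"] exI[of _ "n1 - n2"]) simp
  next
    fix b assume "((\<lambda>j. 0), b) \<in> T'"
    then obtain u b1 n where *: "(u, b1) \<in> T" "(\<lambda>j. 0) = (\<lambda>j. u j + n * v j)" "b = b1 \<otimes> a [^] n"
      by (auto simp: T'_def)
    \<comment> \<open>An element of \<open>T'\<close> over zero comes from a multiple of
      \<open>v\<close> in the old domain, so \<open>compat\<close> determines its value.\<close>
    have "u = (\<lambda>j. (- n) * v j)" using fun_cong[OF *(2)] by (auto simp: algebra_simps eq_neg_iff_add_eq_0)
    then have "b1 = a [^] (- n)" using compat[of "- n" b1] *(1) by simp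
    then show "b = \<one>" using * a by (simp add: int_pow_neg)
  qed
  ultimately show ?thesis by blast
qed

text \<open>Zorn's lemma on graphs above \<open>T0\<close> ordered by inclusion. A maximal graph has
  full domain, since \<open>step\<close> supplies an admissible value at any missing vector; total
  and single-valued, it is the function \<open>f\<close>.\<close>

lemma partial_hom_extend:
  assumes T0: "partial_hom G T0"
    and step: "\<And>T v. \<lbrakk>partial_hom G T; T0 \<subseteq> T; v \<notin> Domain T\<rbrakk> \<Longrightarrow>
      \<exists>a\<in>carrier G. \<forall>n b. ((\<lambda>j. n * v j), b) \<in> T \<longrightarrow> b = a [^] (n::int)"
  obtains f where "\<And>u. f u \<in> carrier G" "\<And>u v. f (\<lambda>j. u j + v j) = f u \<otimes> f v"
    "\<And>u a. (u, a) \<in> T0 \<Longrightarrow> f u = a"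
proof -
  let ?A = "{T. partial_hom G T \<and> T0 \<subseteq> T}"
  have "\<exists>M\<in>?A. \<forall>T\<in>?A. M \<subseteq> T \<longrightarrow> T = M"
  proof (rule subset_Zorn_nonempty)
    show "?A \<noteq> {}" using T0 by blast
    fix \<C> assume ne: "\<C> \<noteq> {}" and chain: "subset.chain ?A \<C>"
    have ph: "partial_hom G T" if "T \<in> \<C>" for T
      using chain that by (auto simp: subset.chain_def)
    have "partial_hom G (\<Union>\<C>)"
      unfolding partial_hom_def
    proof (intro conjI allI impI)
      show "\<Union>\<C> \<noteq> {}" using ne ph by (auto simp: partial_hom_def)
      show "snd ` \<Union>\<C> \<subseteq> carrier G" using ph by (fastforce simp: partial_hom_def)
    next
      fix u a v b assume "(u, a) \<in> \<Union>\<C>" "(v, b) \<in> \<Union>\<C>"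
      then obtain T1 T2 where "T1 \<in> \<C>" "(u, a) \<in> T1" "T2 \<in> \<C>" "(v, b) \<in> T2" by blast
      moreover from this have "T1 \<subseteq> T2 \<or> T2 \<subseteq> T1" using chain unfolding subset_chain_def by blast
      ultimately obtain T where T: "T \<in> \<C>" "(u, a) \<in> T" "(v, b) \<in> T" by blast
      then show "((\<lambda>j. u j - v j), a \<otimes> inv b) \<in> \<Union>\<C>"
        using partial_hom_diff[OF ph[OF T(1)] T(2,3)] by blast
    next
      fix a assume "((\<lambda>j. 0), a) \<in> \<Union>\<C>"
      then show "a = \<one>" using ph partial_hom_zero by blast
    qed
    moreover have "T0 \<subseteq> \<Union>\<C>" using ne chain unfolding subset_chain_def by blast
    ultimately show "\<Union>\<C> \<in> ?A" by blast
  qed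
  then obtain M where MA: "M \<in> ?A" and maxA: "\<forall>T\<in>?A. M \<subseteq> T \<longrightarrow> T = M" ..
  have M: "partial_hom G M" "T0 \<subseteq> M" using MA by simp_all
  have max: "T = M" if "partial_hom G T" "M \<subseteq> T" for T
    using maxA that M(2) by simp
  have dom: "\<exists>a. (v, a) \<in> M" for v
  proof (rule ccontr)
    assume "\<nexists>a. (v, a) \<in> M"
    then have v: "v \<notin> Domain M" by blast
    obtain a where a: "a \<in> carrier G" "\<And>n b. ((\<lambda>j. n * v j), b) \<in> M \<Longrightarrow> b = a [^] (n::int)"
      using step[OF M v] by blast
    obtain T where T: "partial_hom G T" "M \<subseteq> T" "v \<in> Domain T"
      using partial_hom_extend_by_one[OF M(1) a] by blast
    show False using v T(3) unfolding max[OF T(1,2)] ..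
  qed
  define f where "f v = (SOME a. (v, a) \<in> M)" for v
  have f: "(v, f v) \<in> M" for v
    unfolding f_def using dom by (rule someI_ex)
  show thesis
  proof (rule that)
    show "f u \<in> carrier G" for u using partial_hom_closed[OF M(1) f] .
    show "f (\<lambda>j. u j + v j) = f u \<otimes> f v" for u v
      using partial_hom_unique[OF M(1) f partial_hom_add[OF M(1) f f]] .
    show "f u = a" if "(u, a) \<in> T0" for u a
      using partial_hom_unique[OF M(1) f, of u a] M(2) that by blast
  qed
qed

section \<open>Homomorphisms with prescribed values on independent rows\<close>

text \<open>The intended map sends row \<open>r w\<close> to \<open>d w\<close> and all multiples of
  \<open>p\<close> to \<open>\<one>\<close>. It is well defined: if a combination of rows plus a
  multiple of \<open>p\<close> vanishes, independence makes \<open>p\<close> divide every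
  coefficient, and \<open>p\<close>-th powers of the \<open>d w\<close> are trivial.\<close>

lemma partial_hom_of_rows:
  fixes r :: "'e \<Rightarrow> 'j \<Rightarrow> int"
  assumes indep: "\<And>S c. \<lbrakk>finite S; S \<subseteq> E; \<forall>j. int p dvd (\<Sum>w\<in>S. c w * r w j)\<rbrakk> \<Longrightarrow> \<forall>w\<in>S. int p dvd c w"
    and d: "\<And>w. w \<in> E \<Longrightarrow> d w \<in> carrier G"
    and exp: "\<And>a. a \<in> carrier G \<Longrightarrow> a [^] p = \<one>"
  shows "partial_hom G {((\<lambda>j. (\<Sum>w\<in>S. c w * r w j) + int p * u j), finprod G (\<lambda>w. d w [^] (c w :: int)) S) |
      S c u. finite S \<and> S \<subseteq> E}" (is "partial_hom G ?T")
  unfolding partial_hom_def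
proof (intro conjI allI impI)
  show "?T \<noteq> {}" by (auto intro!: exI[of _ "{}"])
  have fin: "finprod G (\<lambda>w. d w [^] (c w :: int)) S \<in> carrier G" if "S \<subseteq> E" for S c
    using that d by (intro finprod_closed) auto
  then show "snd ` ?T \<subseteq> carrier G" by auto
next
  fix u a v b assume "(u, a) \<in> ?T" "(v, b) \<in> ?T"
  then obtain S1 c1 u1 S2 c2 u2 where
      *: "finite S1" "S1 \<subseteq> E" "u = (\<lambda>j. (\<Sum>w\<in>S1. c1 w * r w j) + int p * u1 j)"
        "a = finprod G (\<lambda>w. d w [^] (c1 w :: int)) S1"
        "finite S2" "S2 \<subseteq> E" "v = (\<lambda>j. (\<Sum>w\<in>S2. c2 w * r w j) + int p * u2 j)"
        "b = finprod G (\<lambda>w. d w [^] (c2 w :: int)) S2"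
    by auto
  \<comment> \<open>Both combinations are padded with zero coefficients to a common support, so that
    they can be subtracted termwise.\<close>
  define S where "S = S1 \<union> S2"
  define e1 e2 where "e1 w = (if w \<in> S1 then c1 w else 0)" and "e2 w = (if w \<in> S2 then c2 w else 0)" for w
  have S: "finite S" "S \<subseteq> E" using * by (auto simp: S_def)
  have dS: "d w \<in> carrier G" if "w \<in> S" for w using S d that by auto
  have a: "a = finprod G (\<lambda>w. d w [^] e1 w) S"
    unfolding * using S dS by (intro finprod_mono_neutral_cong_left) (auto simp: e1_def S_def)
  have b: "b = finprod G (\<lambda>w. d w [^] e2 w) S"
    unfolding * using S dS by (intro finprod_mono_neutral_cong_left) (auto simp: e2_def S_def)
  have s1: "(\<Sum>w\<in>S1. c1 w * r w j) = (\<Sum>w\<in>S. e1 w * r w j)" for j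
    using S by (intro sum.mono_neutral_cong_left) (auto simp: e1_def S_def)
  have s2: "(\<Sum>w\<in>S2. c2 w * r w j) = (\<Sum>w\<in>S. e2 w * r w j)" for j
    using S by (intro sum.mono_neutral_cong_left) (auto simp: e2_def S_def)
  have eq1: "(\<lambda>j. u j - v j) = (\<lambda>j. (\<Sum>w\<in>S. (e1 w - e2 w) * r w j) + int p * (u1 j - u2 j))"
    by (auto simp: * s1 s2 algebra_simps sum_subtractf)
  let ?q = "finprod G (\<lambda>w. d w [^] (e1 w - e2 w)) S"
  have clos: "?q \<in> carrier G" "b \<in> carrier G" "a \<in> carrier G"
    using dS unfolding a b by (auto intro!: finprod_closed)
  have "?q \<otimes> b = finprod G (\<lambda>w. d w [^] (e1 w - e2 w) \<otimes> d w [^] e2 w) S"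
    unfolding b using dS by (intro finprod_multf[symmetric]) auto
  also have "\<dots> = a"
    unfolding a using dS by (intro finprod_cong') (auto simp flip: int_pow_mult)
  finally have "a \<otimes> inv b = ?q" using clos by (metis inv_solve_right)
  then show "((\<lambda>j. u j - v j), a \<otimes> inv b) \<in> ?T"
    unfolding eq1 using S
    by (intro CollectI exI[of _ S] exI[of _ "\<lambda>w. e1 w - e2 w"] exI[of _ "\<lambda>j. u1 j - u2 j"]) simp
next
  fix a assume "((\<lambda>j. 0), a) \<in> ?T"
  then obtain S c u where *: "finite S" "S \<subseteq> E" "(\<lambda>j. 0) = (\<lambda>j. (\<Sum>w\<in>S. c w * r w j) + int p * u j)"
    "a = finprod G (\<lambda>w. d w [^] (c w :: int)) S" by auto
  have "int p dvd (\<Sum>w\<in>S. c w * r w j)" for j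
  proof -
    have "(\<Sum>w\<in>S. c w * r w j) = int p * (- u j)" using fun_cong[OF *(3), of j] by simp
    then show ?thesis by simp
  qed
  then have dv: "\<forall>w\<in>S. int p dvd c w" using indep * by blast
  have "d w [^] c w = \<one>" if w: "w \<in> S" for w
  proof -
    obtain q where "c w = int p * q" using dv w by blast
    moreover have dw: "d w \<in> carrier G" using d w *(2) by blast
    ultimately have "d w [^] c w = (d w [^] int p) [^] q" by (simp add: int_pow_pow)
    then show ?thesis using exp[OF dw] by (simp add: int_pow_int)
  qed
  then show "a = \<one>" unfolding * by (rule finprod_one_eqI)
qed

text \<open>Once the domain contains all multiples of \<open>p\<close>, a multiple
  \<open>n * v\<close> in it with \<open>p\<close> not dividing \<open>n\<close> would put
  \<open>v\<close> itself there by Bezout. So \<open>p\<close> divides \<open>n\<close> and the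
  value is trivial; hence \<open>\<one>\<close> is an admissible value at \<open>v\<close>.\<close>

lemma compatible_root_of_prime_exponent:
  assumes T: "partial_hom G T" and v: "v \<notin> Domain T" and p: "Factorial_Ring.prime (p::nat)"
    and multiples: "\<And>u. ((\<lambda>j. int p * u j), \<one>) \<in> T"
    and n: "((\<lambda>j. n * v j), b) \<in> T"
  shows "b = \<one>"
proof -
  have "int p dvd n"
  proof (rule ccontr)
    assume "\<not> int p dvd n"
    then have "coprime (int p) n" using p prime_imp_coprime[of "int p" n] by simp
    then obtain x y where xy: "x * int p + y * n = 1"
      using bezout_int[of "int p" n] by auto
    have "((\<lambda>j. int p * (x * v j) + y * (n * v j)), \<one> \<otimes> b [^] y) \<in> T"
      using partial_hom_add[OF T multiples partial_hom_scale[OF T n]] .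
    moreover have "(\<lambda>j. int p * (x * v j) + y * (n * v j)) = v"
    proof
      fix j
      have "int p * (x * v j) + y * (n * v j) = (x * int p + y * n) * v j" by (simp add: algebra_simps)
      then show "int p * (x * v j) + y * (n * v j) = v j" using xy by simp
    qed
    ultimately show False using v by auto
  qed
  then obtain q where q: "n = int p * q" by blast
  then show ?thesis
    using multiples[of "\<lambda>j. q * v j"] n partial_hom_unique[OF T] by (simp add: mult.assoc)
qed

text \<open>The \<open>n\<close> with \<open>n * v\<close> in the domain form a subgroup of the
  integers, generated by its least positive element \<open>m\<close> if there is one. An
  \<open>m\<close>-th root of the value at \<open>m * v\<close> is then consistent with all of
  them.\<close>

lemma compatible_root_of_divisible:
  assumes T: "partial_hom G T"
    and divisible: "\<And>a n. \<lbrakk>a \<in> carrier G; (n::nat) \<ge> 1\<rbrakk> \<Longrightarrow> \<exists>b\<in>carrier G. a = b [^] n"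
  shows "\<exists>a\<in>carrier G. \<forall>n b. ((\<lambda>j. n * v j), b) \<in> T \<longrightarrow> b = a [^] (n::int)"
proof (cases "\<exists>n::nat. n > 0 \<and> (\<exists>b. ((\<lambda>j. int n * v j), b) \<in> T)")
  case False
  \<comment> \<open>No nonzero multiple of \<open>v\<close> is in the domain, so any value would do;
    \<open>\<one>\<close> is chosen.\<close>
  have "b = \<one> [^] n" if nb: "((\<lambda>j. n * v j), b) \<in> T" for n b
  proof -
    have "n = 0"
    proof (rule ccontr)
      assume "n \<noteq> 0"
      have "int (nat \<bar>n\<bar>) = sgn n * n" by (auto simp: sgn_if)
      then have "((\<lambda>j. int (nat \<bar>n\<bar>) * v j), b [^] (sgn n)) \<in> T"
        using partial_hom_scale[OF T nb, of "sgn n"] by (simp only: mult.assoc)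
      then show False using False \<open>n \<noteq> 0\<close> by (metis zero_less_abs_iff zero_less_nat_eq)
    qed
    then show ?thesis using nb partial_hom_zero[OF T] by simp
  qed
  then show ?thesis by blast
next
  case True
  define m where "m = (LEAST n::nat. n > 0 \<and> (\<exists>b. ((\<lambda>j. int n * v j), b) \<in> T))"
  have m: "m > 0" "\<exists>b. ((\<lambda>j. int m * v j), b) \<in> T"
    using LeastI_ex[OF True] unfolding m_def by blast+
  have least: "\<not> (\<exists>b. ((\<lambda>j. int k * v j), b) \<in> T)" if "0 < k" "k < m" for k
    using not_less_Least that unfolding m_def by blast
  obtain b where b: "((\<lambda>j. int m * v j), b) \<in> T" using m by blast
  obtain a where a: "a \<in> carrier G" "b = a [^] m"
    using divisible[OF partial_hom_closed[OF T b], of m] m by auto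
  have "b' = a [^] n" if n: "((\<lambda>j. n * v j), b') \<in> T" for n b'
  proof -
    \<comment> \<open>Division with remainder: the remainder times \<open>v\<close> is again in the
      domain, so minimality of \<open>m\<close> forces it to be zero.\<close>
    let ?q = "n div int m" and ?k = "nat (n mod int m)"
    have k: "int ?k = n mod int m" using m by simp
    have eq: "(\<lambda>j. n * v j - ?q * (int m * v j)) = (\<lambda>j. int ?k * v j)"
      unfolding k by (auto simp: minus_div_mult_eq_mod[symmetric] algebra_simps)
    have "((\<lambda>j. int ?k * v j), b' \<otimes> inv (b [^] ?q)) \<in> T"
      using partial_hom_diff[OF T n partial_hom_scale[OF T b, of ?q]] unfolding eq .
    moreover have "?k < m" using m by (simp add: nat_less_iff)
    ultimately have "?k = 0" using least by blast
    then have "n = int m * ?q" using k by auto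
    moreover have "b [^] ?q = a [^] (int m * ?q)"
      using a by (simp add: int_pow_int flip: int_pow_pow)
    moreover have "((\<lambda>j. int m * ?q * v j), b [^] ?q) \<in> T"
      using partial_hom_scale[OF T b, of ?q] by (simp add: ac_simps)
    ultimately show ?thesis using n partial_hom_unique[OF T] by metis
  qed
  then show ?thesis using a by blast
qed

text \<open>Two cases run in parallel: \<open>p\<close> prime for a group of exponent
  \<open>p\<close>, where new vectors receive \<open>\<one>\<close>, and \<open>p = 0\<close> for a
  divisible group, where independence is over the integers and new vectors receive roots.\<close>

lemma exists_hom_with_values_on_rows:
  fixes r :: "'e \<Rightarrow> 'j \<Rightarrow> int"
  assumes indep: "\<And>S c. \<lbrakk>finite S; S \<subseteq> E; \<forall>j. int p dvd (\<Sum>w\<in>S. c w * r w j)\<rbrakk> \<Longrightarrow> \<forall>w\<in>S. int p dvd c w"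
    and d: "\<And>w. w \<in> E \<Longrightarrow> d w \<in> carrier G"
    and exp: "\<And>a. a \<in> carrier G \<Longrightarrow> a [^] p = \<one>"
    and p: "Factorial_Ring.prime p \<or>
      (p = 0 \<and> (\<forall>a\<in>carrier G. \<forall>n::nat. n \<ge> 1 \<longrightarrow> (\<exists>b\<in>carrier G. a = b [^] n)))"
  obtains f where "\<And>u. f u \<in> carrier G" "\<And>u v. f (\<lambda>j. u j + v j) = f u \<otimes> f v"
    "\<And>w. w \<in> E \<Longrightarrow> f (r w) = d w"
proof -
  define T0 where "T0 = {((\<lambda>j. (\<Sum>w\<in>S. c w * r w j) + int p * u j), finprod G (\<lambda>w. d w [^] (c w :: int)) S) |
      S c u. finite S \<and> S \<subseteq> E}"
  have T0: "partial_hom G T0"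
    unfolding T0_def using indep d exp by (rule partial_hom_of_rows)
  have rows: "(r w, d w) \<in> T0" if "w \<in> E" for w
  proof -
    have "((\<lambda>j. (\<Sum>w\<in>{w}. 1 * r w j) + int p * 0), finprod G (\<lambda>w. d w [^] (1::int)) {w}) \<in> T0"
      unfolding T0_def using that
      by (intro CollectI exI[of _ "{w}"] exI[of _ "\<lambda>_. 1"] exI[of _ "\<lambda>_. 0"]) auto
    then show ?thesis using d[OF that] by simp
  qed
  have multiples: "((\<lambda>j. int p * u j), \<one>) \<in> T0" for u
    unfolding T0_def by (intro CollectI exI[of _ "{}"] exI[of _ u] exI) auto
  have step: "\<exists>a\<in>carrier G. \<forall>n b. ((\<lambda>j. n * v j), b) \<in> T \<longrightarrow> b = a [^] (n::int)"
    if T: "partial_hom G T" "T0 \<subseteq> T" "v \<notin> Domain T" for T v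
    using p
  proof
    assume "Factorial_Ring.prime p"
    then have "b = \<one>" if "((\<lambda>j. n * v j), b) \<in> T" for n b
      using compatible_root_of_prime_exponent[OF T(1,3) _ _ that] multiples T(2) by blast
    then have "\<forall>n b. ((\<lambda>j. n * v j), b) \<in> T \<longrightarrow> b = \<one> [^] (n::int)"
      by (metis int_pow_one)
    then show ?thesis by blast
  next
    assume "p = 0 \<and> (\<forall>a\<in>carrier G. \<forall>n::nat. n \<ge> 1 \<longrightarrow> (\<exists>b\<in>carrier G. a = b [^] n))"
    then show ?thesis using compatible_root_of_divisible[OF T(1)] by blast
  qed
  show thesis
  proof (rule partial_hom_extend[OF T0 step])
    fix f assume f: "\<And>u. f u \<in> carrier G" "\<And>u v. f (\<lambda>j. u j + v j) = f u \<otimes> f v"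
      "\<And>u a. (u, a) \<in> T0 \<Longrightarrow> f u = a"
    show thesis using f(1,2) f(3)[OF rows] by (rule that)
  qed
qed

end

section \<open>Solving unimodular systems\<close>

lemma eval_word_simps [simp]:
  "eval_word G s [] = \<one>\<^bsub>G\<^esub>"
  "eval_word G s (l # w) = letter_val G s l \<otimes>\<^bsub>G\<^esub> eval_word G s w"
  by (simp_all add: eval_word_def)

lemma exp_sum_Nil: "exp_sum [] = (\<lambda>j. 0)"
  by (simp add: exp_sum_def fun_eq_iff)

lemma exp_sum_Cons: "exp_sum (l # w) = (\<lambda>j. letter_exp j l + exp_sum w j)"
  by (simp add: exp_sum_def fun_eq_iff)

lemma is_equation_Cons:
  "is_equation G (l # w) \<longleftrightarrow> (\<forall>g. l = Inl g \<longrightarrow> g \<in> carrier G) \<and> is_equation G w"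
  by (auto simp: is_equation_def)

text \<open>Being \<open>0\<close>-nonsingular means independence over \<open>\<rat>\<close>, since \<open>0\<close> divides only \<open>0\<close>.\<close>
lemma unimodular_imp_p_nonsingular_0:
  assumes "unimodular E"
  shows "p_nonsingular 0 E"
  unfolding p_nonsingular_def
proof (intro allI impI)
  fix S c assume *: "finite S \<and> S \<subseteq> E \<and> (\<forall>j. int 0 dvd (\<Sum>w\<in>S. c w * exp_sum w j))"
  have two: "p_nonsingular 2 E" using assms by (simp add: unimodular_def)
  \<comment> \<open>Descent at the prime 2: an integral relation has even coefficients, and halving
    them gives another relation. So all powers of 2 divide each coefficient, which must
    vanish.\<close>
  have "\<forall>w\<in>S. 2 ^ k dvd c w" if "\<forall>j. (\<Sum>w\<in>S. c w * exp_sum w j) = 0" for k :: nat and c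
    using that
  proof (induction k arbitrary: c)
    case (Suc k)
    have dv: "\<forall>w\<in>S. int 2 dvd c w"
      using two * Suc.prems unfolding p_nonsingular_def by (metis dvd_0_right)
    have "2 * (\<Sum>w\<in>S. (c w div 2) * exp_sum w j) = (\<Sum>w\<in>S. c w * exp_sum w j)" for j
      unfolding sum_distrib_left using dv by (intro sum.cong) auto
    then have "\<forall>w\<in>S. 2 ^ k dvd c w div 2" using Suc by (intro Suc.IH[of "\<lambda>w. c w div 2"]) simp
    then have "2 * 2 ^ k dvd 2 * (c w div 2)" if "w \<in> S" for w
      using that by (intro mult_dvd_mono) auto
    moreover have "2 * (c w div 2) = c w" if "w \<in> S" for w
      using dv that by simp
    ultimately show ?case by (metis power_Suc)
  qed simp
  then have pow: "2 ^ k dvd c w" if "w \<in> S" for k :: nat and w using * that by simp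
  show "\<forall>w\<in>S. int 0 dvd c w"
  proof
    fix w assume w: "w \<in> S"
    show "int 0 dvd c w"
    proof (rule ccontr)
      assume "\<not> int 0 dvd c w"
      then have "2 ^ nat \<bar>c w\<bar> \<le> \<bar>c w\<bar>"
        using dvd_imp_le_int[OF _ pow[OF w, of "nat \<bar>c w\<bar>"]] by simp
      moreover have "int (nat \<bar>c w\<bar>) < int (2 ^ nat \<bar>c w\<bar>)"
        by (simp only: of_nat_less_iff less_exp)
      ultimately show False by simp
    qed
  qed
qed

text \<open>Interpolates between no condition (\<open>N = carrier G\<close>) and an actual solution
  (\<open>N = {\<one>}\<close>), so that \<open>N\<close> can be lowered along a normal
  series.\<close>

definition solvable_mod :: "('a,'b) monoid_scheme \<Rightarrow> ('a,'j) word set \<Rightarrow> 'a set \<Rightarrow> bool" where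
  "solvable_mod G E N \<longleftrightarrow> (\<exists>s. (\<forall>j. s j \<in> carrier G) \<and> (\<forall>w\<in>E. eval_word G s w \<in> N))"

context group
begin

lemma letter_val_closed:
  "\<lbrakk>\<And>j. s j \<in> carrier G; \<And>g. l = Inl g \<Longrightarrow> g \<in> carrier G\<rbrakk> \<Longrightarrow> letter_val G s l \<in> carrier G"
  by (cases "(G, s, l)" rule: letter_val.cases) auto

lemma eval_word_closed:
  assumes "\<And>j. s j \<in> carrier G" "is_equation G w"
  shows "eval_word G s w \<in> carrier G"
  using assms(2)
  by (induction w) (auto simp: is_equation_Cons intro!: letter_val_closed assms(1))

end

text \<open>The images of the corrections \<open>y j\<close> are central, so they can be collected
  at the right end of the word. Each occurs as often as the exponent sum says, and additivity of
  \<open>f\<close> turns their product into its value at the row.\<close>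

lemma (in group_hom) hom_eval_word_perturb:
  fixes f :: "('j \<Rightarrow> int) \<Rightarrow> 'c"
  assumes s: "\<And>j. s j \<in> carrier G" and y: "\<And>j. y j \<in> carrier G"
    and f: "\<And>u. f u \<in> carrier H" and f_add: "\<And>u v. f (\<lambda>j. u j + v j) = f u \<otimes>\<^bsub>H\<^esub> f v"
    and f_central: "\<And>u g. g \<in> carrier G \<Longrightarrow> f u \<otimes>\<^bsub>H\<^esub> h g = h g \<otimes>\<^bsub>H\<^esub> f u"
    and fy: "\<And>j. h (y j) = f (\<lambda>i. if i = j then 1 else 0)"
    and w: "is_equation G w"
  shows "h (eval_word G (\<lambda>j. s j \<otimes> y j) w) = h (eval_word G s w) \<otimes>\<^bsub>H\<^esub> f (exp_sum w)"
proof -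
  let ?\<delta> = "\<lambda>j i. if i = j then 1 else (0::int)"
  have f0: "f (\<lambda>j. 0) = \<one>\<^bsub>H\<^esub>"
    using f_add[of "\<lambda>_. 0" "\<lambda>_. 0"] f H.l_cancel_one[of "f (\<lambda>j. 0)" "f (\<lambda>j. 0)"] by simp
  have f_neg: "f (\<lambda>j. - u j) = inv\<^bsub>H\<^esub> f u" for u
    using f_add[of "\<lambda>j. - u j" u] f f0 by (simp add: H.inv_equality)
  show ?thesis
    using w
  proof (induction w)
    case Nil
    then show ?case using f0 by (simp add: exp_sum_Nil)
  next
    case (Cons l w)
    define e where "e = h (eval_word G s w)"
    have ev: "eval_word G s w \<in> carrier G" "eval_word G (\<lambda>j. s j \<otimes> y j) w \<in> carrier G"
      using Cons.prems s y by (auto simp: is_equation_Cons intro!: G.eval_word_closed)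
    then have e: "e \<in> carrier H" by (simp add: e_def)
    have IH: "h (eval_word G (\<lambda>j. s j \<otimes> y j) w) = e \<otimes>\<^bsub>H\<^esub> f (exp_sum w)"
      using Cons by (simp add: is_equation_Cons e_def)
    have ce: "f u \<otimes>\<^bsub>H\<^esub> e = e \<otimes>\<^bsub>H\<^esub> f u" for u
      using f_central[OF ev(1)] by (simp add: e_def)
    consider g where "l = Inl g" "g \<in> carrier G" | j where "l = Inr (j, True)" | j where "l = Inr (j, False)"
      using Cons.prems by (cases l) (auto simp: is_equation_Cons)
    then show ?case
    proof cases
      case 1
      then have "exp_sum (l # w) = exp_sum w" by (simp add: exp_sum_Cons)
      then show ?thesis using 1 IH ev e f by (simp add: H.m_assoc e_def)
    next
      case 2
      have "exp_sum (l # w) = (\<lambda>i. ?\<delta> j i + exp_sum w i)" using 2 by (auto simp: exp_sum_Cons)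
      then have "f (exp_sum (l # w)) = f (?\<delta> j) \<otimes>\<^bsub>H\<^esub> f (exp_sum w)"
        by (simp only: f_add)
      moreover have "h (s j) \<otimes>\<^bsub>H\<^esub> f (?\<delta> j) \<otimes>\<^bsub>H\<^esub> (e \<otimes>\<^bsub>H\<^esub> f (exp_sum w))
          = h (s j) \<otimes>\<^bsub>H\<^esub> e \<otimes>\<^bsub>H\<^esub> (f (?\<delta> j) \<otimes>\<^bsub>H\<^esub> f (exp_sum w))"
      proof -
        have "f (?\<delta> j) \<otimes>\<^bsub>H\<^esub> (e \<otimes>\<^bsub>H\<^esub> f (exp_sum w)) = e \<otimes>\<^bsub>H\<^esub> (f (?\<delta> j) \<otimes>\<^bsub>H\<^esub> f (exp_sum w))"
          using ce e f by (simp flip: H.m_assoc)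
        then show ?thesis using s e f by (simp add: H.m_assoc)
      qed
      ultimately show ?thesis using 2 IH ev s y fy by (simp add: e_def)
    next
      case 3
      have "exp_sum (l # w) = (\<lambda>i. - ?\<delta> j i + exp_sum w i)" using 3 by (auto simp: exp_sum_Cons)
      then have "f (exp_sum (l # w)) = f (\<lambda>i. - ?\<delta> j i) \<otimes>\<^bsub>H\<^esub> f (exp_sum w)"
        by (simp only: f_add)
      \<comment> \<open>Inverting \<open>s j \<otimes> y j\<close> reverses the factors, so here the
        central one stands first and must also pass the inverse of \<open>h (s j)\<close>.\<close>
      moreover have "f (\<lambda>i. - ?\<delta> j i) \<otimes>\<^bsub>H\<^esub> inv\<^bsub>H\<^esub> h (s j) \<otimes>\<^bsub>H\<^esub> (e \<otimes>\<^bsub>H\<^esub> f (exp_sum w))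
          = inv\<^bsub>H\<^esub> h (s j) \<otimes>\<^bsub>H\<^esub> e \<otimes>\<^bsub>H\<^esub> (f (\<lambda>i. - ?\<delta> j i) \<otimes>\<^bsub>H\<^esub> f (exp_sum w))"
      proof -
        let ?a = "f (\<lambda>i. - ?\<delta> j i)"
        have "?a \<otimes>\<^bsub>H\<^esub> h (inv (s j)) = h (inv (s j)) \<otimes>\<^bsub>H\<^esub> ?a"
          using s by (intro f_central) simp
        then have c: "?a \<otimes>\<^bsub>H\<^esub> inv\<^bsub>H\<^esub> h (s j) = inv\<^bsub>H\<^esub> h (s j) \<otimes>\<^bsub>H\<^esub> ?a" using s by simp
        have "?a \<otimes>\<^bsub>H\<^esub> (e \<otimes>\<^bsub>H\<^esub> f (exp_sum w)) = e \<otimes>\<^bsub>H\<^esub> (?a \<otimes>\<^bsub>H\<^esub> f (exp_sum w))"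
          using ce e f by (simp flip: H.m_assoc)
        then show ?thesis using c s e f by (simp add: H.m_assoc)
      qed
      moreover have "h (inv (s j \<otimes> y j)) = f (\<lambda>i. - ?\<delta> j i) \<otimes>\<^bsub>H\<^esub> inv\<^bsub>H\<^esub> h (s j)"
        unfolding f_neg using s y fy by (simp add: G.inv_mult_group)
      ultimately show ?thesis using 3 IH ev s y by (simp add: e_def)
    qed
  qed
qed

section \<open>Correcting a solution along a central series\<close>

context group
begin

text \<open>The errors of the given solution lie in the image of \<open>N\<close> in
  \<open>G Mod M\<close>, which is central. A homomorphism taking each row to the inverse of its
  error prescribes corrections of the variables that cancel all errors at once.\<close>

lemma solvable_mod_central_step:
  fixes E :: "('a,'j) word set"
  assumes N: "N \<lhd> G" and M: "M \<lhd> G"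
    and central: "\<And>x g. \<lbrakk>x \<in> N; g \<in> carrier G\<rbrakk> \<Longrightarrow> commutator G x g \<in> M"
    and eqs: "\<And>w. w \<in> E \<Longrightarrow> is_equation G w"
    and indep: "p_nonsingular p E"
    and exp: "\<And>x. x \<in> N \<Longrightarrow> x [^] p \<in> M"
    and p: "Factorial_Ring.prime p \<or>
      (p = 0 \<and> (\<forall>x\<in>N. \<forall>n::nat. n \<ge> 1 \<longrightarrow> (\<exists>y\<in>N. x = y [^] n)))"
    and sol: "solvable_mod G E N"
  shows "solvable_mod G E M"
proof -
  interpret N: normal N G by fact
  interpret M: normal M G by fact
  let ?Q = "G Mod M"
  note [simp del] = mult_FactGroup one_FactGroup
  interpret q: group_hom G ?Q "r_coset G M" by (rule M.group_hom_quotient)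
  let ?A = "?Q\<lparr>carrier := (\<lambda>x. M #> x) ` N\<rparr>"
  have subA: "subgroup ((\<lambda>x. M #> x) ` N) ?Q"
    using q.subgroup_img_is_subgroup[OF N.subgroup_axioms] .
  have Nc: "x \<in> carrier G" if "x \<in> N" for x using that N.subset by blast
  interpret A: group ?A using q.H.subgroup_imp_group[OF subA] .
  have comm: "(M #> x) \<otimes>\<^bsub>?Q\<^esub> (M #> g) = (M #> g) \<otimes>\<^bsub>?Q\<^esub> (M #> x)" if "x \<in> N" "g \<in> carrier G" for x g
    using M.quotient_commute[OF Nc[OF that(1)] that(2) central[OF that]] .
  interpret A: comm_group ?A
    by (rule A.group_comm_groupI) (use comm Nc in auto)
  have powA: "(M #> x) [^]\<^bsub>?A\<^esub> n = M #> (x [^] n)" if "x \<in> N" for x and n :: nat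
    using that Nc by (simp add: q.hom_nat_pow flip: q.H.nat_pow_consistent)
  obtain s where s: "\<And>j. s j \<in> carrier G" "\<And>w. w \<in> E \<Longrightarrow> eval_word G s w \<in> N"
    using sol by (auto simp: solvable_mod_def)
  \<comment> \<open>The value that the correction must contribute to equation
    \<open>w\<close>.\<close>
  let ?d = "\<lambda>w. inv\<^bsub>?A\<^esub> (M #> eval_word G s w)"
  obtain f :: "('j \<Rightarrow> int) \<Rightarrow> 'a set" where f: "\<And>u. f u \<in> carrier ?A"
      "\<And>u v. f (\<lambda>j. u j + v j) = f u \<otimes>\<^bsub>?A\<^esub> f v"
      "\<And>w. w \<in> E \<Longrightarrow> f (exp_sum w) = ?d w"
  proof (rule A.exists_hom_with_values_on_rows[of E p exp_sum ?d])
    show "\<forall>w\<in>S. int p dvd c w" if "finite S" "S \<subseteq> E" "\<forall>j. int p dvd (\<Sum>w\<in>S. c w * exp_sum w j)" for S c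
      using indep that unfolding p_nonsingular_def by blast
    show "?d w \<in> carrier ?A" if "w \<in> E" for w
      using s(2)[OF that] by (intro A.inv_closed) simp
    show "a [^]\<^bsub>?A\<^esub> p = \<one>\<^bsub>?A\<^esub>" if "a \<in> carrier ?A" for a
    proof -
      from that obtain x where x: "x \<in> N" "a = M #> x" by auto
      then show ?thesis
        using powA[OF x(1), of p] M.quotient_eq_one_iff[of "x [^] p"] exp[OF x(1)] Nc[OF x(1)] by simp
    qed
    have "\<exists>b\<in>carrier ?A. a = b [^]\<^bsub>?A\<^esub> n"
      if div: "\<forall>x\<in>N. \<forall>n::nat. n \<ge> 1 \<longrightarrow> (\<exists>y\<in>N. x = y [^] n)" and "a \<in> carrier ?A" "n \<ge> 1" for a and n :: nat
    proof -
      from that obtain x where "x \<in> N" "a = M #> x" by auto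
      moreover from this obtain y where "y \<in> N" "x = y [^] n" using div \<open>n \<ge> 1\<close> by blast
      ultimately show ?thesis by (intro bexI[of _ "M #> y"]) (simp_all add: powA)
    qed
    then show "Factorial_Ring.prime p \<or>
      (p = 0 \<and> (\<forall>a\<in>carrier ?A. \<forall>n::nat. n \<ge> 1 \<longrightarrow> (\<exists>b\<in>carrier ?A. a = b [^]\<^bsub>?A\<^esub> n)))"
      using p by blast
  qed (rule that)
  \<comment> \<open>The correction of variable \<open>j\<close> is a lift to \<open>N\<close> of the
    value of \<open>f\<close> at the \<open>j\<close>-th unit vector.\<close>
  have "\<exists>x\<in>N. M #> x = f (\<lambda>i. if i = j then 1 else 0)" for j
    using f(1)[of "\<lambda>i. if i = j then 1 else 0"] by auto
  then obtain y where y: "\<And>j. y j \<in> N" "\<And>j. M #> y j = f (\<lambda>i. if i = j then 1 else 0)"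
    by metis
  have "eval_word G (\<lambda>j. s j \<otimes> y j) w \<in> M" if w: "w \<in> E" for w
  proof -
    have "M #> eval_word G (\<lambda>j. s j \<otimes> y j) w = (M #> eval_word G s w) \<otimes>\<^bsub>?Q\<^esub> f (exp_sum w)"
    proof (rule q.hom_eval_word_perturb)
      show "f u \<in> carrier ?Q" for u using f(1)[of u] subgroup.subset[OF subA] by auto
      show "f u \<otimes>\<^bsub>?Q\<^esub> (M #> g) = (M #> g) \<otimes>\<^bsub>?Q\<^esub> f u" if "g \<in> carrier G" for u g
      proof -
        obtain x where "x \<in> N" "f u = M #> x" using f(1)[of u] by auto
        then show ?thesis using comm that by simp
      qed
      show "f (\<lambda>j. u j + v j) = f u \<otimes>\<^bsub>?Q\<^esub> f v" for u v using f(2) by simp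
    qed (use s y Nc eqs w in auto)
    also have "\<dots> = (M #> eval_word G s w) \<otimes>\<^bsub>?A\<^esub> ?d w" using f(3)[OF w] by simp
    also have "\<dots> = \<one>\<^bsub>?A\<^esub>" using s(2)[OF w] by (intro A.r_inv) simp
    finally have "M #> eval_word G (\<lambda>j. s j \<otimes> y j) w = \<one>\<^bsub>?Q\<^esub>" by simp
    moreover have "eval_word G (\<lambda>j. s j \<otimes> y j) w \<in> carrier G"
      using s y Nc eqs w by (intro eval_word_closed) auto
    ultimately show ?thesis using M.quotient_eq_one_iff by blast
  qed
  then show ?thesis
    unfolding solvable_mod_def using s y Nc by (intro exI[of _ "\<lambda>j. s j \<otimes> y j"]) auto
qed

text \<open>The image of \<open>N\<close> modulo \<open>M\<close> is abelian, so \<open>k\<close>-th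
  powers define a homomorphism on it, and the set is its kernel pulled back to
  \<open>N\<close>.\<close>

lemma normal_roots_mod:
  assumes N: "N \<lhd> G" and M: "M \<lhd> G"
    and central: "\<And>x g. \<lbrakk>x \<in> N; g \<in> carrier G\<rbrakk> \<Longrightarrow> commutator G x g \<in> M"
  shows "{x \<in> N. x [^] (k::nat) \<in> M} \<lhd> G"
proof -
  interpret N: normal N G by fact
  interpret M: normal M G by fact
  note [simp del] = mult_FactGroup one_FactGroup
  interpret q: group_hom G "G Mod M" "r_coset G M" by (rule M.group_hom_quotient)
  have Nc: "x \<in> carrier G" if "x \<in> N" for x using that N.subset by blast
  have "subgroup {x \<in> N. x [^] k \<in> M} G"
  proof
    fix x y assume xy: "x \<in> {x \<in> N. x [^] k \<in> M}" "y \<in> {x \<in> N. x [^] k \<in> M}"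
    then have c: "x \<in> carrier G" "y \<in> carrier G" using Nc by auto
    have "(M #> x) \<otimes>\<^bsub>G Mod M\<^esub> (M #> y) = (M #> y) \<otimes>\<^bsub>G Mod M\<^esub> (M #> x)"
      using M.quotient_commute[OF c] central xy c by blast
    then have "M #> ((x \<otimes> y) [^] k) = (M #> (x [^] k)) \<otimes>\<^bsub>G Mod M\<^esub> (M #> (y [^] k))"
      using c q.H.pow_mult_distrib[of "M #> x" "M #> y" k] by (simp add: q.hom_nat_pow)
    also have "\<dots> = \<one>\<^bsub>G Mod M\<^esub>"
      using xy c M.quotient_eq_one_iff[of "x [^] k"] M.quotient_eq_one_iff[of "y [^] k"] by simp
    finally show "x \<otimes> y \<in> {x \<in> N. x [^] k \<in> M}"
      using xy c M.quotient_eq_one_iff by auto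
  next
    fix x assume "x \<in> {x \<in> N. x [^] k \<in> M}"
    then show "inv x \<in> {x \<in> N. x [^] k \<in> M}" using Nc by (simp add: nat_pow_inv)
  qed (use Nc in auto)
  then show ?thesis
  proof (rule normal_invI)
    fix g x assume g: "g \<in> carrier G" and x: "x \<in> {x \<in> N. x [^] k \<in> M}"
    then have xc: "x \<in> carrier G" using Nc by auto
    have "(g \<otimes> x \<otimes> inv g) [^] n = g \<otimes> x [^] n \<otimes> inv g" for n :: nat
      using g xc by (induction n) (simp_all add: m_assoc)
    then show "g \<otimes> x \<otimes> inv g \<in> {x \<in> N. x [^] k \<in> M}"
      using g x by (simp add: N.inv_op_closed2 M.inv_op_closed2)
  qed
qed

text \<open>With \<open>K = p * k\<close>, the elements of \<open>N\<close> whose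
  \<open>k\<close>-th power is in \<open>M\<close> form an intermediate term: above it the section
  has exponent \<open>p\<close>, and below it exponent \<open>k < K\<close>, which the induction
  handles.\<close>

lemma solvable_mod_bounded_central_step:
  fixes E :: "('a,'j) word set"
  assumes N: "N \<lhd> G" and M: "M \<lhd> G" and MN: "M \<subseteq> N"
    and central: "\<And>x g. \<lbrakk>x \<in> N; g \<in> carrier G\<rbrakk> \<Longrightarrow> commutator G x g \<in> M"
    and eqs: "\<And>w. w \<in> E \<Longrightarrow> is_equation G w"
    and E: "unimodular E"
    and K: "(K::nat) \<ge> 1" "\<And>x. x \<in> N \<Longrightarrow> x [^] K \<in> M"
    and sol: "solvable_mod G E N"
  shows "solvable_mod G E M"
  using N MN central K sol
proof (induction K arbitrary: N rule: less_induct)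
  case (less K)
  interpret N: normal N G by fact
  show ?case
  proof (cases "K = 1")
    case True
    then have "N \<subseteq> M" using less.prems(5) N.subset by auto
    then show ?thesis using less.prems(6) unfolding solvable_mod_def by blast
  next
    case False
    then obtain p where p: "Factorial_Ring.prime p" "p dvd K" using prime_factor_nat by blast
    then obtain k where k: "K = p * k" by blast
    have k1: "k \<ge> 1" using k less.prems(4) by (cases k) auto
    have kK: "k < K" using k k1 prime_gt_1_nat[OF p(1)] by simp
    let ?N = "{x \<in> N. x [^] k \<in> M}"
    have M_pow: "x [^] n \<in> M" if "x \<in> M" for x and n :: nat
    proof -
      interpret M: normal M G by fact
      show ?thesis using that by (induction n) auto
    qed
    have N': "?N \<lhd> G" using less.prems(1) M less.prems(3) by (rule normal_roots_mod)
    have "M \<subseteq> ?N" using less.prems(2) M_pow by auto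
    have "solvable_mod G E ?N"
    proof (rule solvable_mod_central_step[of N ?N E p])
      show "commutator G x g \<in> ?N" if "x \<in> N" "g \<in> carrier G" for x g
        using less.prems(3)[OF that] \<open>M \<subseteq> ?N\<close> by blast
      show "p_nonsingular p E" using E p by (simp add: unimodular_def)
      show "x [^] p \<in> ?N" if x: "x \<in> N" for x
      proof -
        have "(x [^] p) [^] k = x [^] K" using x N.subset k by (simp add: nat_pow_pow subset_iff)
        moreover have "x [^] p \<in> N" using x by (induction p) auto
        ultimately show ?thesis using less.prems(5)[OF x] by simp
      qed
    qed (use less.prems N' eqs p in auto)
    then show ?thesis
      using less.IH[OF kK N' \<open>M \<subseteq> ?N\<close> _ k1] less.prems(3) by blast
  qed
qed

end

context periodic_nilpotent
begin

text \<open>Centrality of \<open>D\<close> lets products \<open>l \<otimes> d\<close> be multiplied,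
  inverted and conjugated in each factor separately.\<close>

lemma lower_central_mult_D_normal: "lower_central G i <#> D \<lhd> G"
proof -
  interpret L: normal "lower_central G i" G by (rule lower_central_normal)
  interpret D: subgroup D G by (rule divisible_part_subgroup)
  note cen = divisible_part_central
  let ?S = "lower_central G i <#> D"
  have mem: "x \<in> ?S \<longleftrightarrow> (\<exists>l\<in>lower_central G i. \<exists>d\<in>D. x = l \<otimes> d)" for x
    by (auto simp: set_mult_def)
  have Lc: "l \<in> carrier G" if "l \<in> lower_central G i" for l using that L.subset by blast
  have Dc: "d \<in> carrier G" if "d \<in> D" for d using that D.subset by blast
  have "subgroup ?S G"
  proof
    show "?S \<subseteq> carrier G" using Lc Dc by (auto simp: mem)
    show "\<one> \<in> ?S" unfolding mem by (intro bexI[of _ \<one>]) auto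
  next
    fix x y assume "x \<in> ?S" "y \<in> ?S"
    then obtain l d l' d' where *: "l \<in> lower_central G i" "d \<in> D" "x = l \<otimes> d"
        "l' \<in> lower_central G i" "d' \<in> D" "y = l' \<otimes> d'" by (auto simp: mem)
    have "x \<otimes> y = (l \<otimes> l') \<otimes> (d \<otimes> d')"
    proof -
      have "d \<otimes> (l' \<otimes> d') = l' \<otimes> (d \<otimes> d')"
        using * Lc Dc cen[of d l'] by (simp flip: m_assoc)
      then show ?thesis using * Lc Dc by (simp add: m_assoc)
    qed
    then show "x \<otimes> y \<in> ?S" using * mem by blast
  next
    fix x assume "x \<in> ?S"
    then obtain l d where *: "l \<in> lower_central G i" "d \<in> D" "x = l \<otimes> d" by (auto simp: mem)
    then have "inv x = inv l \<otimes> inv d"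
      using Lc Dc cen[of "inv d" "inv l"] by (simp add: inv_mult_group)
    then show "inv x \<in> ?S" using * mem by blast
  qed
  then show ?thesis
  proof (rule normal_invI)
    fix g x assume g: "g \<in> carrier G" and "x \<in> ?S"
    then obtain l d where *: "l \<in> lower_central G i" "d \<in> D" "x = l \<otimes> d" by (auto simp: mem)
    have "d \<otimes> inv g = inv g \<otimes> d" using cen[of d "inv g"] * g by simp
    then have "g \<otimes> x \<otimes> inv g = (g \<otimes> l \<otimes> inv g) \<otimes> d"
      using * g Lc Dc by (simp add: m_assoc)
    then show "g \<otimes> x \<otimes> inv g \<in> ?S"
      using * g L.inv_op_closed2 mem by blast
  qed
qed

text \<open>The terms \<open>lower_central G i <#> D\<close> run from \<open>G\<close> down to
  \<open>D\<close>. All sections are central of exponent dividing \<open>K\<close>, because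
  \<open>K\<close>-th powers lie in \<open>D\<close>; the last step goes from the divisible group
  \<open>D\<close> to \<open>{\<one>}\<close>.\<close>

theorem unimodular_solvable:
  fixes E :: "('a,'j) word set"
  assumes K: "(K::nat) \<ge> 1" "\<And>g. g \<in> carrier G \<Longrightarrow> g [^] K \<in> D"
    and eqs: "\<And>w. w \<in> E \<Longrightarrow> is_equation G w" and E: "unimodular E"
  shows "has_solution G E"
proof -
  interpret D: subgroup D G by (rule divisible_part_subgroup)
  let ?N = "\<lambda>i. lower_central G i <#> D"
  have mem: "x \<in> ?N i \<longleftrightarrow> (\<exists>l\<in>lower_central G i. \<exists>d\<in>D. x = l \<otimes> d)" for x i
    by (auto simp: set_mult_def)
  have Lc: "l \<in> carrier G" if "l \<in> lower_central G i" for l i using that lower_central_subset by blast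
  have Dc: "d \<in> carrier G" if "d \<in> D" for d using that D.subset by blast
  have DN: "D \<subseteq> ?N i" for i
  proof
    fix d assume d: "d \<in> D"
    have "\<one> \<in> lower_central G i"
      using subgroup.one_closed[OF normal_imp_subgroup[OF lower_central_normal]] .
    then show "d \<in> ?N i" unfolding mem using d Dc l_one by force
  qed
  have "solvable_mod G E (?N i)" for i
  proof (induction i)
    case 0
    have "carrier G \<subseteq> ?N 0"
    proof
      fix x assume "x \<in> carrier G"
      then have "x = x \<otimes> \<one>" "x \<in> lower_central G 0" by auto
      then show "x \<in> ?N 0" unfolding mem using D.one_closed by blast
    qed
    then have "\<forall>w\<in>E. eval_word G (\<lambda>_. \<one>) w \<in> ?N 0"
      using eval_word_closed[of "\<lambda>_. \<one>"] eqs by auto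
    then show ?case unfolding solvable_mod_def by (intro exI[of _ "\<lambda>_. \<one>"]) auto
  next
    case (Suc i)
    have sub: "?N (Suc i) \<subseteq> ?N i"
      using mono_set_mult[OF lower_central_Suc_subset order_refl] .
    have comm: "commutator G x g \<in> ?N (Suc i)" if x: "x \<in> ?N i" and g: "g \<in> carrier G" for x g
    proof -
      obtain l d where ld: "l \<in> lower_central G i" "d \<in> D" "x = l \<otimes> d" using x mem by blast
      have "commutator G x g = commutator G l g"
        unfolding ld(3) using Lc[OF ld(1)] g Dc[OF ld(2)] divisible_part_central[OF ld(2)]
        by (rule commutator_mult_central_left)
      also have "\<dots> = commutator G l g \<otimes> \<one>"
        using Lc ld g by (intro r_one[symmetric]) auto
      finally show ?thesis
        unfolding mem using commutator_in_lower_central[OF ld(1) g] D.one_closed by blast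
    qed
    have pow: "x [^] K \<in> ?N (Suc i)" if "x \<in> ?N i" for x
    proof -
      have "x \<in> carrier G" using that mem Lc Dc by auto
      then show ?thesis using K(2) DN by blast
    qed
    show ?case
      by (rule solvable_mod_bounded_central_step[OF lower_central_mult_D_normal
          lower_central_mult_D_normal sub comm eqs E K(1) pow Suc])
  qed
  then have "solvable_mod G E (?N c)" .
  moreover have "?N c = D"
    unfolding lower_central_c using Dc by (auto simp: set_mult_def)
  ultimately have solD: "solvable_mod G E D" by simp
  have "solvable_mod G E {\<one>}"
  proof (rule solvable_mod_central_step[of D _ E 0])
    show "D \<lhd> G" using lower_central_mult_D_normal[of c] \<open>?N c = D\<close> by simp
    show "{\<one>} \<lhd> G" by (rule one_is_normal)
    show "commutator G x g \<in> {\<one>}" if "x \<in> D" "g \<in> carrier G" for x g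
      using that divisible_part_central Dc by (simp add: commutator_eq_one_iff)
    show "p_nonsingular 0 E" using E by (rule unimodular_imp_p_nonsingular_0)
    \<comment> \<open>Boundedness makes \<open>D\<close> divisible within itself: the root of degree
      \<open>K * n\<close> in \<open>G\<close>, raised to the power \<open>K\<close>, is an
      \<open>n\<close>-th root inside \<open>D\<close>.\<close>
    have "\<exists>y\<in>D. x = y [^] n" if xn: "x \<in> D" "n \<ge> 1" for x and n :: nat
    proof -
      obtain h where h: "h \<in> carrier G" "x = h [^] (K * n)"
        using divisible_partD[OF xn(1), of "K * n"] K(1) xn(2) by auto
      then have "x = (h [^] K) [^] n" by (simp add: nat_pow_pow)
      then show ?thesis using K(2)[OF h(1)] by blast
    qed
    then show "Factorial_Ring.prime (0::nat) \<or>
        ((0::nat) = 0 \<and> (\<forall>x\<in>D. \<forall>n::nat. n \<ge> 1 \<longrightarrow> (\<exists>y\<in>D. x = y [^] n)))" by blast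
  qed (use eqs solD in auto)
  then show ?thesis by (auto simp: solvable_mod_def has_solution_def)
qed

end

section \<open>Unsolvable systems\<close>

text \<open>The relations \<open>x\<^sub>i = a\<^sub>i x\<^sub>i\<^sub>+\<^sub>1\<^sup>n\<close> with \<open>n = n\<^sub>i\<close> express \<open>x\<^sub>0\<close> as \<open>S\<^sub>m\<close> times an
  \<open>N\<^sub>m\<close>-th power, where \<open>S\<close> and \<open>N\<close> are built so that \<open>S\<^bsub>m+1\<^esub>\<close> raised to the power \<open>m!\<close> is not an
  \<open>n\<^sub>m\<close>-th power. Hence no factorial kills \<open>x\<^sub>0\<close>.\<close>
lemma (in comm_group) unsolvable_chain:
  assumes torsion: "\<And>a. a \<in> carrier G \<Longrightarrow> \<exists>n::nat. n \<ge> 1 \<and> a [^] n = \<one>"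
    and unbounded: "\<And>N::nat. N \<ge> 1 \<Longrightarrow>
      \<exists>a\<in>carrier G. \<exists>n::nat. n \<ge> 1 \<and> (\<forall>h\<in>carrier G. a [^] N \<noteq> h [^] n)"
  shows "\<exists>(a :: nat \<Rightarrow> 'a) (n :: nat \<Rightarrow> nat). (\<forall>i. a i \<in> carrier G) \<and>
    \<not> (\<exists>x. \<forall>i. x i \<in> carrier G \<and> x i = a i \<otimes> x (Suc i) [^] n i)"
proof -
  \<comment> \<open>The state after \<open>m\<close> choices is the pair of \<open>S\<close> and
    \<open>N\<close>; \<open>?good\<close> says that the pair of \<open>a\<close> and
    \<open>n\<close> leads to the next state and blocks \<open>fact m\<close> as an exponent for
    \<open>x 0\<close>.\<close>
  let ?P = "\<lambda>(m::nat) SN. fst SN \<in> carrier G \<and> snd SN \<ge> (1::nat) \<and> (m = 0 \<longrightarrow> SN = (\<one>, 1))"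
  let ?good = "\<lambda>m SN SN' an. fst an \<in> carrier G \<and> snd an \<ge> (1::nat) \<and>
    fst SN' = fst SN \<otimes> fst an [^] snd SN \<and> snd SN' = snd SN * snd an \<and>
    (\<forall>h\<in>carrier G. fst SN' [^] (fact m :: nat) \<noteq> h [^] snd an)"
  have step: "\<exists>SN'. ?P (Suc m) SN' \<and> (\<exists>an. ?good m SN SN' an)" if P: "?P m SN" for m SN
  proof -
    obtain S N where SN: "SN = (S, N)" "S \<in> carrier G" "N \<ge> 1" using P by (cases SN) auto
    have "\<exists>a\<in>carrier G. \<exists>n::nat. n \<ge> 1 \<and> (\<forall>h\<in>carrier G. (S \<otimes> a [^] N) [^] (fact m :: nat) \<noteq> h [^] n)"
    \<comment> \<open>Either \<open>S\<close> already fails to have some root, and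
      \<open>a = \<one>\<close> keeps it; or its power has all roots, and an \<open>a\<close>
      failing at exponent \<open>N * fact m\<close> cannot be compensated by it.\<close>
    proof (cases "\<exists>n::nat. n \<ge> 1 \<and> (\<forall>h\<in>carrier G. S [^] (fact m :: nat) \<noteq> h [^] n)")
      case True
      then show ?thesis using SN by (intro bexI[of _ \<one>]) auto
    next
      case False
      have "N * fact m \<ge> 1" using SN(3) by (simp add: Suc_leI)
      then obtain a and n :: nat where a: "a \<in> carrier G" and n: "n \<ge> 1"
        and an: "\<forall>h\<in>carrier G. a [^] (N * fact m) \<noteq> h [^] n"
        using unbounded by blast
      obtain k where k: "k \<in> carrier G" "S [^] (fact m :: nat) = k [^] n" using False n by blast
      have "(S \<otimes> a [^] N) [^] (fact m :: nat) \<noteq> h [^] n" if h: "h \<in> carrier G" for h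
      proof
        assume "(S \<otimes> a [^] N) [^] (fact m :: nat) = h [^] n"
        then have "k [^] n \<otimes> a [^] (N * fact m) = h [^] n"
          using SN a k by (simp add: nat_pow_distrib nat_pow_pow)
        then have "a [^] (N * fact m) = inv (k [^] n) \<otimes> h [^] n"
          using k a h by (simp add: inv_solve_left)
        also have "\<dots> = (inv k \<otimes> h) [^] n"
          using k h by (simp add: nat_pow_distrib nat_pow_inv)
        finally show False using an k h by blast
      qed
      then show ?thesis using a n by blast
    qed
    then obtain a and n :: nat where an: "a \<in> carrier G" "n \<ge> 1"
      "\<forall>h\<in>carrier G. (S \<otimes> a [^] N) [^] (fact m :: nat) \<noteq> h [^] n" by blast
    show ?thesis
      using an SN by (intro exI[of _ "(S \<otimes> a [^] N, N * n)"] conjI exI[of _ "(a, n)"]) auto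
  qed
  have "\<exists>F. \<forall>m. ?P m (F m) \<and> (\<exists>an. ?good m (F m) (F (Suc m)) an)"
    by (rule dependent_nat_choice) (simp, rule step)
  then obtain F where F: "\<And>m. ?P m (F m)" "\<forall>m. \<exists>an. ?good m (F m) (F (Suc m)) an" by blast
  obtain an where an: "\<And>m. ?good m (F m) (F (Suc m)) (an m)"
    using choice[OF F(2)] by blast
  define S N where "S m = fst (F m)" and "N m = snd (F m)" for m
  define a n where "a m = fst (an m)" and "n m = snd (an m)" for m
  have S0: "S 0 = \<one>" "N 0 = 1" using F(1)[of 0] by (auto simp: S_def N_def)
  have Sc: "S m \<in> carrier G" for m using F(1)[of m] by (simp add: S_def)
  have S_Suc: "S (Suc m) = S m \<otimes> a m [^] N m" "N (Suc m) = N m * n m" for m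
    using an[of m] by (simp_all add: S_def N_def a_def n_def)
  have a: "a m \<in> carrier G" for m using an[of m] by (simp add: a_def)
  have not_pow: "S (Suc m) [^] (fact m :: nat) \<noteq> h [^] n m" if "h \<in> carrier G" for m h
    using an[of m] that unfolding S_def n_def by blast
  show ?thesis
  proof (intro exI[of _ a] exI[of _ n] conjI allI a notI)
    assume "\<exists>x. \<forall>i. x i \<in> carrier G \<and> x i = a i \<otimes> x (Suc i) [^] n i"
    then obtain x where x: "\<And>i. x i \<in> carrier G" and rec: "\<And>i. x i = a i \<otimes> x (Suc i) [^] n i"
      by blast
    have x0: "x 0 = S m \<otimes> x m [^] N m" for m
    proof (induction m)
      case 0
      then show ?case using S0 x by simp
    next
      case (Suc m)
      have "x m [^] N m = a m [^] N m \<otimes> x (Suc m) [^] N (Suc m)"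
        using rec[of m] x a by (simp add: nat_pow_distrib nat_pow_pow S_Suc mult.commute)
      then show ?case using Suc x a Sc by (simp add: S_Suc m_assoc)
    qed
    \<comment> \<open>An exponent \<open>m\<close> killing \<open>x 0\<close> is also used as the
      index in the chain. Since \<open>m\<close> divides \<open>fact m\<close>, the power of
      \<open>S (Suc m)\<close> becomes an \<open>n m\<close>-th power, which was excluded.\<close>
    obtain m :: nat where m: "m \<ge> 1" "x 0 [^] m = \<one>" using torsion x by blast
    then obtain q where q: "(fact m :: nat) = m * q" using dvd_fact[of m m] by auto
    let ?y = "x (Suc m) [^] (N m * fact m)"
    have "x 0 [^] (fact m :: nat) = \<one>" using m x by (simp add: q flip: nat_pow_pow)
    then have "S (Suc m) [^] (fact m :: nat) \<otimes> ?y [^] n m = \<one>"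
    proof -
      have "x 0 [^] (fact m :: nat) = S (Suc m) [^] (fact m :: nat) \<otimes> (x (Suc m) [^] N (Suc m)) [^] (fact m :: nat)"
        unfolding x0[of "Suc m"] using Sc x by (intro nat_pow_distrib) auto
      moreover have "(x (Suc m) [^] N (Suc m)) [^] (fact m :: nat) = ?y [^] n m"
        using x by (simp add: nat_pow_pow S_Suc ac_simps)
      ultimately show ?thesis using \<open>x 0 [^] (fact m :: nat) = \<one>\<close> by simp
    qed
    then have "S (Suc m) [^] (fact m :: nat) = inv (?y [^] n m)"
      using Sc x by (simp add: inv_equality)
    also have "\<dots> = inv ?y [^] n m" using x by (simp add: nat_pow_inv)
    finally show False using not_pow[of "inv ?y" m] x by simp
  qed
qed

section \<open>Chains as unimodular systems\<close>

definition chain_word :: "(nat \<Rightarrow> 'j) \<Rightarrow> (nat \<Rightarrow> 'a) \<Rightarrow> (nat \<Rightarrow> nat) \<Rightarrow> nat \<Rightarrow> ('a,'j) word" where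
  "chain_word v a n i = Inr (v i, False) # Inl (a i) # replicate (n i) (Inr (v (Suc i), True))"

lemma exp_sum_chain_word:
  "exp_sum (chain_word v a n i) j =
    (if v i = j then - 1 else 0) + (if v (Suc i) = j then int (n i) else 0)"
  by (simp add: chain_word_def exp_sum_def sum_list_replicate)

text \<open>The matrix of rows is triangular with \<open>- 1\<close> on the diagonal: column
  \<open>v i\<close> meets only row \<open>i\<close> and, through its last variable, row
  \<open>i - 1\<close>. Coefficients are thus shown divisible in order of \<open>i\<close>.\<close>

lemma unimodular_chain:
  assumes v: "inj v"
  shows "unimodular (range (chain_word v a n))"
  unfolding unimodular_def p_nonsingular_def
proof (intro allI impI)
  fix p S c
  assume *: "finite S \<and> S \<subseteq> range (chain_word v a n) \<and> (\<forall>j. int p dvd (\<Sum>w\<in>S. c w * exp_sum w j))"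
  have "int p dvd c (chain_word v a n i)" if "chain_word v a n i \<in> S" for i
    using that
  proof (induction i rule: less_induct)
    case (less i)
    let ?w = "chain_word v a n i"
    have "int p dvd c w * exp_sum w (v i)" if "w \<in> S - {?w}" for w
    proof -
      from that * obtain k where k: "w = chain_word v a n k" by blast
      then have ki: "k \<noteq> i" using that by blast
      show ?thesis
      proof (cases "Suc k = i")
        case True
        then have "int p dvd c w" using less.IH[of k] k that by auto
        then show ?thesis by simp
      next
        case False
        then have "exp_sum w (v i) = 0"
          using ki v by (simp add: k exp_sum_chain_word inj_eq)
        then show ?thesis by simp
      qed
    qed
    then have "int p dvd (\<Sum>w\<in>S - {?w}. c w * exp_sum w (v i))" by (rule dvd_sum)
    moreover have "(\<Sum>w\<in>S. c w * exp_sum w (v i))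
        = c ?w * exp_sum ?w (v i) + (\<Sum>w\<in>S - {?w}. c w * exp_sum w (v i))"
      using * less.prems by (intro sum.remove) auto
    moreover have "int p dvd (\<Sum>w\<in>S. c w * exp_sum w (v i))" using * by blast
    ultimately have "int p dvd c ?w * exp_sum ?w (v i)"
      by (simp add: dvd_add_left_iff)
    then show ?case using v by (simp add: exp_sum_chain_word inj_eq)
  qed
  then show "\<forall>w\<in>S. int p dvd c w" using * by blast
qed

context group
begin

lemma eval_word_replicate:
  "s j \<in> carrier G \<Longrightarrow> eval_word G s (replicate n (Inr (j, True))) = s j [^] n"
proof (induction n)
  case (Suc n)
  then show ?case using nat_pow_Suc2[of "s j" n] by simp
qed simp

text \<open>An infinite variable type contains a sequence of distinct variables, over which the
  recursion is a unimodular system.\<close>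

lemma solvable_chain:
  fixes a :: "nat \<Rightarrow> 'a"
  assumes inf: "infinite (UNIV :: 'j set)"
    and solv: "\<And>E :: ('a,'j) word set. \<lbrakk>\<forall>w\<in>E. is_equation G w; unimodular E\<rbrakk> \<Longrightarrow> has_solution G E"
    and a: "\<And>i. a i \<in> carrier G"
  shows "\<exists>x. \<forall>i. x i \<in> carrier G \<and> x i = a i \<otimes> x (Suc i) [^] (n i :: nat)"
proof -
  obtain v :: "nat \<Rightarrow> 'j" where v: "inj v"
    using infinite_countable_subset[OF inf] by blast
  have "\<forall>w\<in>range (chain_word v a n). is_equation G w"
    using a by (auto simp: is_equation_def chain_word_def)
  then have "has_solution G (range (chain_word v a n))"
    using unimodular_chain[OF v] by (rule solv)
  then obtain s where s: "\<And>j. s j \<in> carrier G" "\<And>i. eval_word G s (chain_word v a n i) = \<one>"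
    unfolding has_solution_def by blast
  have "s (v i) = a i \<otimes> s (v (Suc i)) [^] n i" for i
  proof -
    have "inv s (v i) \<otimes> (a i \<otimes> s (v (Suc i)) [^] n i) = \<one>"
      using s(2)[of i] s(1) by (simp add: chain_word_def eval_word_replicate)
    then have "s (v i) \<otimes> (inv s (v i) \<otimes> (a i \<otimes> s (v (Suc i)) [^] n i)) = s (v i) \<otimes> \<one>"
      by simp
    then show ?thesis using s(1) a by simp
  qed
  then show ?thesis by (intro exI[of _ "\<lambda>i. s (v i)"] allI conjI s(1))
qed

lemma comm_group_abelianization: "comm_group (G Mod lower_central G (Suc 0))"
proof -
  interpret M: normal "lower_central G (Suc 0)" G by (rule lower_central_normal)
  note [simp del] = mult_FactGroup one_FactGroup
  interpret Q: group "G Mod lower_central G (Suc 0)" by (rule M.factorgroup_is_group)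
  show ?thesis
  proof (rule Q.group_comm_groupI)
    fix x y assume "x \<in> carrier (G Mod lower_central G (Suc 0))" "y \<in> carrier (G Mod lower_central G (Suc 0))"
    then obtain g h where gh: "g \<in> carrier G" "x = lower_central G (Suc 0) #> g"
      "h \<in> carrier G" "y = lower_central G (Suc 0) #> h"
      unfolding carrier_FactGroup by blast
    have "g \<in> lower_central G 0" using gh by simp
    from M.quotient_commute[OF gh(1,3) commutator_in_lower_central[OF this gh(3)]]
    show "x \<otimes>\<^bsub>G Mod lower_central G (Suc 0)\<^esub> y = y \<otimes>\<^bsub>G Mod lower_central G (Suc 0)\<^esub> x"
      unfolding gh .
  qed
qed

text \<open>Modulo term \<open>i + 2\<close> the values of \<open>[a, -]\<close> are central, which
  makes this map multiplicative. Its image is then commutative, so it kills all commutators and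
  hence the derived subgroup \<open>lower_central G (Suc 0)\<close>.\<close>

lemma commutator_with_derived:
  assumes a: "a \<in> lower_central G i"
  shows "group_hom G (G Mod lower_central G (Suc (Suc i))) (\<lambda>y. lower_central G (Suc (Suc i)) #> commutator G a y)"
    and "d \<in> lower_central G (Suc 0) \<Longrightarrow> commutator G a d \<in> lower_central G (Suc (Suc i))"
proof -
  let ?M = "lower_central G (Suc (Suc i))"
  interpret M: normal ?M G by (rule lower_central_normal)
  let ?Q = "G Mod ?M"
  note [simp del] = mult_FactGroup one_FactGroup lower_central.simps(2)
  interpret q: group_hom G ?Q "r_coset G ?M" by (rule M.group_hom_quotient)
  have ac: "a \<in> carrier G" using a lower_central_subset by blast
  let ?f = "\<lambda>y. ?M #> commutator G a y"
  have cen: "?f y \<otimes>\<^bsub>?Q\<^esub> (?M #> g) = (?M #> g) \<otimes>\<^bsub>?Q\<^esub> ?f y" if "y \<in> carrier G" "g \<in> carrier G" for y g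
    using M.quotient_commute[OF commutator_closed[OF ac that(1)] that(2)]
      commutator_in_lower_central[OF commutator_in_lower_central[OF a that(1)] that(2)] by blast
  show hom: "group_hom G ?Q ?f"
  proof (unfold_locales, rule homI)
    fix y z assume yz: "y \<in> carrier G" "z \<in> carrier G"
    show "?f (y \<otimes> z) = ?f y \<otimes>\<^bsub>?Q\<^esub> ?f z"
      using q.H.commutator_mult_right[of "?M #> a" "?M #> y" "?M #> z"] cen[OF yz(2,1)] ac yz
      by (simp add: q.hom_commutator)
  qed (use ac in auto)
  interpret f: group_hom G ?Q ?f by (rule hom)
  have "comm_set G (carrier G) (carrier G) \<subseteq> kernel G ?Q ?f"
  proof
    fix z assume "z \<in> comm_set G (carrier G) (carrier G)"
    then obtain x y where xy: "x \<in> carrier G" "y \<in> carrier G" "z = commutator G x y"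
      unfolding comm_set_eq by blast
    have "?f z = commutator ?Q (?f x) (?f y)" unfolding xy(3) using f.hom_commutator[OF xy(1,2)] .
    also have "\<dots> = \<one>\<^bsub>?Q\<^esub>"
      using cen[OF xy(1), of "commutator G a y"] ac xy
      by (subst q.H.commutator_eq_one_iff) auto
    finally show "z \<in> kernel G ?Q ?f" using xy by (simp add: kernel_def)
  qed
  then have "generate G (comm_set G (carrier G) (carrier G)) \<subseteq> kernel G ?Q ?f"
    using f.subgroup_kernel by (rule generate_subgroup_incl)
  then show "commutator G a d \<in> ?M" if "d \<in> lower_central G (Suc 0)"
    using that M.quotient_eq_one_iff[of "commutator G a d"] ac
    by (auto simp: kernel_def lower_central.simps(2))
qed

end

section \<open>From the abelianization back to the group\<close>

context periodic_nilpotent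
begin

text \<open>For a generator \<open>[a, b]\<close> with \<open>a^m = 1\<close>, write
  \<open>b^N = d h^m\<close>. Modulo the next term \<open>[a, b]^N\<close> is
  \<open>[a, b^N] = [a, d] [a, h^m]\<close>; the first factor vanishes since \<open>d\<close> is in
  the derived subgroup, the second because it agrees with \<open>[a^m, h]\<close>.\<close>

lemma derived_bounded:
  assumes N: "\<And>g n. \<lbrakk>g \<in> carrier G; (n::nat) \<ge> 1\<rbrakk> \<Longrightarrow>
      \<exists>d\<in>lower_central G (Suc 0). \<exists>h\<in>carrier G. g [^] (N::nat) = d \<otimes> h [^] n"
    and x: "x \<in> lower_central G (Suc i)"
  shows "x [^] N \<in> lower_central G (Suc (Suc i))"
proof -
  let ?M = "lower_central G (Suc (Suc i))"
  interpret M: normal ?M G by (rule lower_central_normal)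
  let ?Y = "comm_set G (lower_central G i) (carrier G)"
  show ?thesis
  proof (rule M.pow_generate_mem[OF comm_set_subset])
    show "x \<in> generate G ?Y" using x by simp
    show "commutator G x y \<in> ?M" if "x \<in> generate G ?Y" "y \<in> generate G ?Y" for x y
    proof (rule commutator_in_lower_central)
      show "x \<in> lower_central G (Suc i)" using that by simp
      show "y \<in> carrier G" using that generate_in_carrier[OF comm_set_subset] by blast
    qed
    fix y assume "y \<in> ?Y"
    then obtain a b where ab: "y = commutator G a b" "a \<in> lower_central G i" "b \<in> carrier G"
      unfolding comm_set_eq by blast
    have ac: "a \<in> carrier G" using ab lower_central_subset by blast
    have central: "commutator G (commutator G a z) g \<in> ?M" if "z \<in> carrier G" "g \<in> carrier G" for z g
      using commutator_in_lower_central[OF commutator_in_lower_central[OF ab(2) that(1)] that(2)] .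
    obtain m :: nat where m: "m \<ge> 1" "a [^] m = \<one>" using periodic ac by blast
    obtain d h where dh: "d \<in> lower_central G (Suc 0)" "h \<in> carrier G" "b [^] N = d \<otimes> h [^] m"
      using N[OF ab(3) m(1)] by blast
    have dc: "d \<in> carrier G" using dh(1) lower_central_subset by blast
    interpret f: group_hom G "G Mod ?M" "\<lambda>y. ?M #> commutator G a y"
      using ab(2) by (rule commutator_with_derived)
    have "commutator G (a [^] m) h \<in> ?M"
      unfolding m(2) using dh(2) M.one_closed by (simp add: commutator_def del: lower_central.simps)
    then have "commutator G a (h [^] m) \<in> ?M"
      using M.pow_commutator_mem[OF ac dh(2) central[OF dh(2)]] by blast
    moreover have "commutator G a d \<in> ?M" using ab(2) dh(1) by (rule commutator_with_derived)
    ultimately have "?M #> commutator G a (d \<otimes> h [^] m) = \<one>\<^bsub>G Mod ?M\<^esub>"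
      using f.hom_mult[OF dc, of "h [^] m"] dh(2) dc ac
        M.quotient_eq_one_iff[of "commutator G a d"] M.quotient_eq_one_iff[of "commutator G a (h [^] m)"]
      by (simp del: lower_central.simps one_FactGroup mult_FactGroup)
    then have "commutator G a (b [^] N) \<in> ?M"
      using M.quotient_eq_one_iff[of "commutator G a (b [^] N)"] ac ab(3) unfolding dh(3)[symmetric] by blast
    then show "y [^] N \<in> ?M"
      unfolding ab(1) using M.pow_commutator_mem[OF ac ab(3) central[OF ab(3)]] by blast
  qed
qed

text \<open>The derived subgroup is killed by \<open>N ^ c\<close>. In \<open>g^N = d h^k\<close> a
  further \<open>N ^ c\<close>-th power therefore removes \<open>d\<close>, provided that the two
  factors commute.\<close>

lemma bounded_mod_divisible_part_if_abelianization:
  assumes N: "\<And>g n. \<lbrakk>g \<in> carrier G; (n::nat) \<ge> 1\<rbrakk> \<Longrightarrow>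
      \<exists>d\<in>lower_central G (Suc 0). \<exists>h\<in>carrier G. g [^] (N::nat) = d \<otimes> h [^] n"
    and N1: "N \<ge> 1" and g: "g \<in> carrier G"
  shows "g [^] (N * N ^ c) \<in> D"
proof -
  let ?t = "N ^ c"
  have t1: "?t \<ge> 1" using N1 by simp
  have "d [^] (N ^ k) \<in> lower_central G (Suc k)" if d: "d \<in> lower_central G (Suc 0)" for d k
  proof (induction k)
    case (Suc k)
    have "d \<in> carrier G" using d lower_central_subset by blast
    then have "d [^] (N ^ Suc k) = (d [^] (N ^ k)) [^] N" by (simp add: nat_pow_pow mult.commute)
    then show ?case using derived_bounded[OF N Suc] by (simp only:)
  next
    case 0
    have "d \<in> carrier G" using d lower_central_subset by blast
    then show ?case using d by (simp del: lower_central.simps)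
  qed
  then have kill: "d [^] ?t = \<one>" if "d \<in> lower_central G (Suc 0)" for d
    using that lower_central_trivial_mono[OF lower_central_c, of "Suc c"]
    by (simp del: lower_central.simps) blast
  have "\<exists>h\<in>carrier G. g [^] (N * ?t) = h [^] n" if n: "n \<ge> 1" for n :: nat
  proof -
    \<comment> \<open>The factor \<open>?t ^ c\<close> in the degree makes the power of
      \<open>h\<close> commute with \<open>d\<close>, which \<open>?t\<close> kills; the factor
      \<open>n\<close> yields the required root.\<close>
    have "?t ^ c * n \<ge> 1" using t1 n by simp
    then obtain d h where dh: "d \<in> lower_central G (Suc 0)" "h \<in> carrier G" "g [^] N = d \<otimes> h [^] (?t ^ c * n)"
      using N[OF g] by blast
    have dc: "d \<in> carrier G" using dh(1) lower_central_subset by blast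
    let ?u = "h [^] (?t ^ c)"
    have "?u \<otimes> d = d \<otimes> ?u"
      using pow_commutes_with_torsion[OF lower_central_c dh(2) dc kill[OF dh(1)]] .
    then have "d \<otimes> ?u [^] n = ?u [^] n \<otimes> d"
      using group_commutes_pow[of ?u d n] dh(2) dc by simp
    then have "(d \<otimes> ?u [^] n) [^] ?t = d [^] ?t \<otimes> (?u [^] n) [^] ?t"
      using dh(2) dc by (intro pow_mult_distrib) auto
    moreover have "g [^] (N * ?t) = (d \<otimes> ?u [^] n) [^] ?t"
      using g dh(2,3) by (simp add: nat_pow_pow[symmetric])
    moreover have "(?u [^] n) [^] ?t = (?u [^] ?t) [^] n"
      using dh(2) by (simp add: nat_pow_pow ac_simps)
    ultimately have "g [^] (N * ?t) = (?u [^] ?t) [^] n"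
      using kill[OF dh(1)] dh(2) by simp
    then show ?thesis using dh(2) by blast
  qed
  then show ?thesis using g by (simp add: divisible_part_def)
qed

text \<open>If no \<open>N\<close> works in the abelianization, there is a chain without solution in
  it. Its coefficients lift to \<open>G\<close>, and a solution of the lifted chain would project to
  one of the original.\<close>

theorem bounded_if_unimodular_solvable:
  assumes inf: "infinite (UNIV :: 'j set)"
    and solv: "\<And>E :: ('a,'j) word set. \<lbrakk>\<forall>w\<in>E. is_equation G w; unimodular E\<rbrakk> \<Longrightarrow> has_solution G E"
  shows "\<exists>K::nat. K \<ge> 1 \<and> (\<forall>g\<in>carrier G. g [^] K \<in> D)"
proof -
  let ?M = "lower_central G (Suc 0)"
  interpret M: normal ?M G by (rule lower_central_normal)
  note [simp del] = mult_FactGroup one_FactGroup lower_central.simps(2)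
  let ?Q = "G Mod ?M"
  interpret q: group_hom G ?Q "r_coset G ?M" by (rule M.group_hom_quotient)
  interpret Q: comm_group ?Q by (rule comm_group_abelianization)
  have rep: "\<exists>g\<in>carrier G. a = ?M #> g" if "a \<in> carrier ?Q" for a
    using that unfolding carrier_FactGroup by blast
  have torsion: "\<exists>n::nat. n \<ge> 1 \<and> a [^]\<^bsub>?Q\<^esub> n = \<one>\<^bsub>?Q\<^esub>" if "a \<in> carrier ?Q" for a
  proof -
    obtain g where g: "g \<in> carrier G" "a = ?M #> g" using rep[OF \<open>a \<in> carrier ?Q\<close>] by blast
    obtain n :: nat where n: "n \<ge> 1" "g [^] n = \<one>" using periodic g by blast
    have "a [^]\<^bsub>?Q\<^esub> n = \<one>\<^bsub>?Q\<^esub>" using g n by (simp flip: q.hom_nat_pow)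
    then show ?thesis using n by blast
  qed
  have "\<exists>N::nat. N \<ge> 1 \<and> (\<forall>a\<in>carrier ?Q. \<forall>n::nat. n \<ge> 1 \<longrightarrow> (\<exists>h\<in>carrier ?Q. a [^]\<^bsub>?Q\<^esub> N = h [^]\<^bsub>?Q\<^esub> n))"
    (is ?bounded)
  proof (rule ccontr)
    assume "\<not> ?bounded"
    then have unb: "\<exists>a\<in>carrier ?Q. \<exists>n::nat. n \<ge> 1 \<and> (\<forall>h\<in>carrier ?Q. a [^]\<^bsub>?Q\<^esub> N \<noteq> h [^]\<^bsub>?Q\<^esub> n)"
      if "N \<ge> 1" for N :: nat using that by blast
    obtain a n where a: "\<And>i. a i \<in> carrier ?Q"
      and no: "\<not> (\<exists>x. \<forall>i. x i \<in> carrier ?Q \<and> x i = a i \<otimes>\<^bsub>?Q\<^esub> x (Suc i) [^]\<^bsub>?Q\<^esub> (n i :: nat))"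
      using Q.unsolvable_chain[OF torsion unb] by blast
    have "\<forall>i. \<exists>g. g \<in> carrier G \<and> a i = ?M #> g" using rep a by blast
    then obtain b where b: "\<And>i. b i \<in> carrier G" "\<And>i. a i = ?M #> b i"
      using choice[of "\<lambda>i g. g \<in> carrier G \<and> a i = ?M #> g"] by blast
    obtain x where x: "\<And>i. x i \<in> carrier G" "\<And>i. x i = b i \<otimes> x (Suc i) [^] n i"
      using solvable_chain[OF inf solv, of b n] b(1) by blast
    have "?M #> x i \<in> carrier ?Q \<and> ?M #> x i = a i \<otimes>\<^bsub>?Q\<^esub> (?M #> x (Suc i)) [^]\<^bsub>?Q\<^esub> n i" for i
    proof -
      have "?M #> x i = ?M #> (b i \<otimes> x (Suc i) [^] n i)" using x(2)[of i] by simp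
      then show ?thesis using x(1) b by (simp add: q.hom_nat_pow)
    qed
    then have "\<exists>y. \<forall>i. y i \<in> carrier ?Q \<and> y i = a i \<otimes>\<^bsub>?Q\<^esub> y (Suc i) [^]\<^bsub>?Q\<^esub> n i"
      by (intro exI[of _ "\<lambda>i. ?M #> x i"] allI)
    then show False using no by (rule notE[rotated])
  qed
  then obtain N :: nat where N1: "N \<ge> 1"
    and N: "\<And>a n. \<lbrakk>a \<in> carrier ?Q; (n::nat) \<ge> 1\<rbrakk> \<Longrightarrow> \<exists>h\<in>carrier ?Q. a [^]\<^bsub>?Q\<^esub> N = h [^]\<^bsub>?Q\<^esub> n"
    by blast
  have "\<exists>d\<in>?M. \<exists>h\<in>carrier G. g [^] N = d \<otimes> h [^] n" if g: "g \<in> carrier G" and n: "n \<ge> 1" for g and n :: nat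
  proof -
    obtain h' where h': "h' \<in> carrier ?Q" "(?M #> g) [^]\<^bsub>?Q\<^esub> N = h' [^]\<^bsub>?Q\<^esub> n"
      using N[OF _ n, of "?M #> g"] g by auto
    then obtain h where h: "h \<in> carrier G" "h' = ?M #> h" using rep by blast
    let ?d = "g [^] N \<otimes> inv (h [^] n)"
    have "?M #> ?d = \<one>\<^bsub>?Q\<^esub>"
      using h' h g by (simp add: q.hom_nat_pow)
    then have "?d \<in> ?M" using M.quotient_eq_one_iff[of ?d] g h by simp
    moreover have "g [^] N = ?d \<otimes> h [^] n" using g h by (simp add: m_assoc)
    ultimately show ?thesis using h by blast
  qed
  then have "\<forall>g\<in>carrier G. g [^] (N * N ^ c) \<in> D"
    using bounded_mod_divisible_part_if_abelianization N1 by blast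
  moreover have "N * N ^ c \<ge> 1" using N1 by simp
  ultimately show ?thesis by blast
qed

end

text \<open>Both conditions are compared with boundedness of \<open>G\<close> modulo
  \<open>divisible_part G\<close>. The infinite variable type gives room for the chains that detect
  unboundedness.\<close>

theorem theorem1:
  fixes G :: "('a,'b) monoid_scheme"
  assumes "nilpotent_group G" and "periodic_group G"
    and "infinite (UNIV :: 'j set)"
  shows "(\<forall>E :: ('a,'j) word set. (\<forall>w\<in>E. is_equation G w) \<and> unimodular E \<longrightarrow> has_solution G E)
     \<longleftrightarrow>
     (finite {p::nat. Factorial_Ring.prime p \<and> nontrivial_group (first_ulm_factor (p_component_group G p) p)} \<and>
      (\<forall>p::nat. Factorial_Ring.prime p \<and> nontrivial_group (first_ulm_factor (p_component_group G p) p)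
          \<longrightarrow> bounded_period (first_ulm_factor (p_component_group G p) p)))"
proof -
  obtain c where c: "group G" "lower_central G c = {\<one>\<^bsub>G\<^esub>}"
    using assms(1) by (auto simp: nilpotent_group_def)
  interpret group G by (rule c(1))
  interpret periodic_nilpotent G c
    using c(2) assms(2) by unfold_locales (auto simp: periodic_group_def)
  show ?thesis
    unfolding ulm_condition_iff
  proof
    assume solv: "\<forall>E :: ('a,'j) word set. (\<forall>w\<in>E. is_equation G w) \<and> unimodular E \<longrightarrow> has_solution G E"
    show "\<exists>K::nat. K \<ge> 1 \<and> (\<forall>g\<in>carrier G. g [^]\<^bsub>G\<^esub> K \<in> divisible_part G)"
      by (rule bounded_if_unimodular_solvable[OF assms(3)]) (use solv in blast)
  next
    assume "\<exists>K::nat. K \<ge> 1 \<and> (\<forall>g\<in>carrier G. g [^]\<^bsub>G\<^esub> K \<in> divisible_part G)"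
    then show "\<forall>E :: ('a,'j) word set. (\<forall>w\<in>E. is_equation G w) \<and> unimodular E \<longrightarrow> has_solution G E"
      using unimodular_solvable by blast
  qed
qed

end
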